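(* Let $1\le\alpha<2$, let $\{X_n,n\ge1\}$ be a sequence of negatively associated, identically distributed real random variables, and let $X$ be a random variable with the same distribution as the $X_n$. Let $L(\cdot)$ be a slowly varying function defined on $[A,\infty)$ for some $A>0$, with de Bruijn conjugate $\tilde L(\cdot)$, also defined on $[A,\infty)$, where $L$ and $\tilde L$ are both bounded on finite closed intervals. When $\alpha=1$, assume further that $L(x)\ge1$ on $[A,\infty)$ and that $L$ is increasing (in the non-strict sense) on $[A,\infty)$. Let $b_n=n^{1/\alpha}\tilde L(n^{1/\alpha})$ for integers $n\ge A^\alpha$, $n\ge 1$. Then the following four statements are equivalent. (i) $E(X)=0$ and $E\left(|X|^\alpha L^\alpha(|X|+A)\right)<\infty$. (ii) For every array of real constants $\{a_{ni},n\ge1,1\le i\le n\}$ for which there is a constant $C$ (not depending on $n$) such that $\sum_{i=1}^n a_{ni}^2\le Cn$ for all $n\ge1$, we have $$\sum_{n\ge A^\alpha}n^{-1}P\left(\max_{1\le k\le n}\left|\sum_{i=1}^k a_{ni}X_i\right|>\varepsilon b_n\right)<\infty\quad\text{for all }\varepsilon>0.$$ (iii) $$\sum_{n\ge A^\alpha}n^{-1}P\left(\max_{1\le k\le n}\left|\sum_{i=1}^k X_i\right|>\varepsilon b_n\right)<\infty\quad\text{for all }\varepsilon>0.$$ (iv) $$\lim_{n\to\infty}\frac{\max_{1\le k\le n}\left|\sum_{i=1}^kX_i\right|}{b_n}=0\quad\text{almost surely.}$$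
   Context: Sums over $n\ge A^\alpha$ run over positive integers $n$ with $n\ge A^\alpha$. $L^\alpha(x)$ means $(L(x))^\alpha$. Slowly varying: a function $L:[A,\infty)\to(0,\infty)$, $A>0$, that is positive and measurable with $\lim_{x\to\infty}L(\lambda x)/L(x)=1$ for every $\lambda>0$. De Bruijn conjugate: for a slowly varying $L$ there is a slowly varying function $\tilde L$, unique up to asymptotic equivalence, such that $\lim_{x\to\infty}L(x)\tilde L(xL(x))=1$ and $\lim_{x\to\infty}\tilde L(x)L(x\tilde L(x))=1$. It is called the de Bruijn conjugate of $L$. Negative association: a finite collection $\{X_1,\dots,X_n\}$ of random variables is negatively associated if for any disjoint subsets $I,J$ of $\{1,\dots,n\}$ and any real coordinatewise nondecreasing functions $f$ on $\mathbb{R}^{|I|}$ and $g$ on $\mathbb{R}^{|J|}$, $\mathrm{Cov}(f(X_k,k\in I),g(X_k,k\in J))\le0$ whenever the covariance exists. A sequence is negatively associated if every finite subfamily is. *)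

theory Defs
  imports "HOL-Probability.Probability"
begin

(* Functions on [A,\<infinity>) are total functions real \<Rightarrow> real whose values outside {A..} are never
   constrained: limits at infinity only see large arguments, and measurability is with respect to
   the trace sigma-algebra on {A..}. *)
definition slowly_varying :: "real \<Rightarrow> (real \<Rightarrow> real) \<Rightarrow> bool" where
  "slowly_varying A L \<longleftrightarrow>
     A > 0 \<and> (\<forall>x\<ge>A. L x > 0) \<and> L \<in> borel_measurable (restrict_space borel {A..}) \<and>
     (\<forall>c>0. ((\<lambda>x. L (c * x) / L x) \<longlongrightarrow> 1) at_top)"

(* A relation rather than a function, since the conjugate is unique only up to asymptotic
   equivalence. The inner arguments x * L x and x * Lt x tend to infinity, so they lie in {A..}
   for all large x. *)
definition de_bruijn_conjugate :: "real \<Rightarrow> (real \<Rightarrow> real) \<Rightarrow> (real \<Rightarrow> real) \<Rightarrow> bool" where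
  "de_bruijn_conjugate A L Lt \<longleftrightarrow>
     slowly_varying A Lt \<and>
     ((\<lambda>x. L x * Lt (x * L x)) \<longlongrightarrow> 1) at_top \<and>
     ((\<lambda>x. Lt x * L (x * Lt x)) \<longlongrightarrow> 1) at_top"

(* Functions on R^I are functions on the extensional product {x. x i = undefined for i not in I}. *)
definition coordwise_nondecreasing :: "'i set \<Rightarrow> (('i \<Rightarrow> real) \<Rightarrow> real) \<Rightarrow> bool" where
  "coordwise_nondecreasing I f \<longleftrightarrow>
     (\<forall>x \<in> I \<rightarrow>\<^sub>E UNIV. \<forall>y \<in> I \<rightarrow>\<^sub>E UNIV. (\<forall>i\<in>I. x i \<le> y i) \<longrightarrow> f x \<le> f y)"

definition covariance_exists :: "'a measure \<Rightarrow> ('a \<Rightarrow> real) \<Rightarrow> ('a \<Rightarrow> real) \<Rightarrow> bool" where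
  "covariance_exists M U V \<longleftrightarrow>
     integrable M U \<and> integrable M V \<and> integrable M (\<lambda>\<omega>. U \<omega> * V \<omega>)"

definition covariance :: "'a measure \<Rightarrow> ('a \<Rightarrow> real) \<Rightarrow> ('a \<Rightarrow> real) \<Rightarrow> real" where
  "covariance M U V =
     (\<integral>\<omega>. (U \<omega> - (\<integral>\<eta>. U \<eta> \<partial>M)) * (V \<omega> - (\<integral>\<eta>. V \<eta> \<partial>M)) \<partial>M)"

(* Negative association of the finite family (X k)_{k \<in> S}. Measurability of the composites
   f(X_k, k \<in> I) and g(X_k, k \<in> J) is part of the existence of their covariance. *)
definition neg_associated_fin :: "'a measure \<Rightarrow> ('i \<Rightarrow> 'a \<Rightarrow> real) \<Rightarrow> 'i set \<Rightarrow> bool" where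
  "neg_associated_fin M X S \<longleftrightarrow>
     (\<forall>I J f g. I \<subseteq> S \<and> J \<subseteq> S \<and> I \<inter> J = {} \<and>
        coordwise_nondecreasing I f \<and> coordwise_nondecreasing J g \<and>
        covariance_exists M (\<lambda>\<omega>. f (\<lambda>k\<in>I. X k \<omega>)) (\<lambda>\<omega>. g (\<lambda>k\<in>J. X k \<omega>)) \<longrightarrow>
        covariance M (\<lambda>\<omega>. f (\<lambda>k\<in>I. X k \<omega>)) (\<lambda>\<omega>. g (\<lambda>k\<in>J. X k \<omega>)) \<le> 0)"

definition neg_associated :: "'a measure \<Rightarrow> ('i \<Rightarrow> 'a \<Rightarrow> real) \<Rightarrow> 'i set \<Rightarrow> bool" where
  "neg_associated M X T \<longleftrightarrow> (\<forall>S. finite S \<and> S \<subseteq> T \<longrightarrow> neg_associated_fin M X S)"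

definition bounded_on_intervals :: "real \<Rightarrow> (real \<Rightarrow> real) \<Rightarrow> bool" where
  "bounded_on_intervals A h \<longleftrightarrow> (\<forall>c d. A \<le> c \<and> c \<le> d \<longrightarrow> bounded (h ` {c..d}))"

(* max over 1 \<le> k \<le> n of |y 1 + ... + y k|; meaningful for n \<ge> 1 only. *)
definition max_partial_sum :: "nat \<Rightarrow> (nat \<Rightarrow> real) \<Rightarrow> real" where
  "max_partial_sum n y = Max ((\<lambda>k. \<bar>\<Sum>i=1..k. y i\<bar>) ` {1..n})"

end

theory Submission
  imports Defs
begin

text \<open>
  Write \<open>G t = (t L (t + A))\<^sup>\<alpha>\<close>. By the uniform convergence theorem and Potter's bounds,
  \<open>t > b n\<close> means \<open>G t\<close> is at least of order \<open>n\<close> and conversely, so \<open>E G |X| < \<infinity>\<close>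
  amounts to \<open>\<Sum>n. P (|X| > b n) < \<infinity>\<close>; since \<open>\<alpha> < 2\<close>, it even gives
  \<open>\<Sum>n. E (min 1 (X / b n)\<^sup>2) < \<infinity>\<close>.

  (i) \<open>\<Longrightarrow>\<close> (ii): truncate monotonically at \<open>\<plusminus> b n\<close>, split the weights into positive and negative
  parts, and use \<open>E (max S\<^sub>k)\<^sup>2 \<le> \<Sum> E Z\<^sub>i\<^sup>2\<close> for centred negatively associated variables.
  (iii) \<open>\<Longrightarrow>\<close> (iv): Borel--Cantelli along powers of two.
  (iv) \<open>\<Longrightarrow>\<close> (i): the events \<open>X n \<le> b n\<close> satisfy a product inequality, which yields
  \<open>\<Sum>n. P (|X n| > b n) < \<infinity>\<close> and hence the moment; the strong law for \<open>X n - E X\<close> then gives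
  \<open>n |E X| / b n \<longrightarrow> 0\<close>, while \<open>b n = O(n)\<close>.
\<close>

section \<open>Slowly varying functions\<close>

text \<open>The link between \<open>G\<close> and \<open>n\<close> comes from the conjugate:
  \<open>x * Lt x\<close> asymptotically inverts \<open>x * L x\<close>. Since \<open>b\<close> need
  not be monotone, this is used only through inequalities with constants, valid for large
  \<open>n\<close>. The range of \<alpha> matters at both ends. Below 2 there is room to lose a
  small power in Potter's bounds and still keep a summable power of \<open>1 / n\<close>. At
  \<alpha> = 1 no power may be lost in first moments: monotonicity of \<open>L\<close> replaces
  Potter's bound when the bias of truncation is estimated, and \<open>L \<ge> 1\<close> replaces it
  in \<open>b n = O(n)\<close>. Negative association is inherited under coordinatewise monotone
  maps, whereas cutting off to 0 or weights of mixed sign may destroy it; hence the clipping, the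
  splitting of weights and the recursive maximal inequality. For necessity the moment must be found
  before the mean is known, so the sufficiency bounds are proved for variables centred at their
  mean.\<close>

text \<open>The classical measure-theoretic argument: for large \<open>x\<close> the points of \<open>{x..x+2}\<close> where
  \<open>h\<close> is far from \<open>h x\<close> have measure below 1/2, so \<open>x\<close> and \<open>x + c\<close> share a good point.\<close>
lemma slowly_varying_additive_uniform:
  fixes h :: "real \<Rightarrow> real"
  assumes [measurable]: "h \<in> borel_measurable borel"
    and lim: "\<And>u. ((\<lambda>x. h (x + u) - h x) \<longlongrightarrow> 0) at_top" and "\<epsilon> > 0"
  shows "\<exists>x0. \<forall>x\<ge>x0. \<forall>c\<in>{0..1}. \<bar>h (x + c) - h x\<bar> \<le> \<epsilon>"
proof -
  define B where "B x = {t. \<bar>h t - h x\<bar> > \<epsilon> / 2} \<inter> {x..x+2}" for x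
  define B0 where "B0 x = {u. \<bar>h (x + u) - h x\<bar> > \<epsilon> / 2} \<inter> {0..2}" for x
  have [measurable]: "B x \<in> sets borel" "B0 x \<in> sets borel" for x
    unfolding B_def B0_def by measurable
  have B_shift: "measure lborel (B x) = measure lborel (B0 x)" for x
  proof -
    have "measure lborel (B x) = measure (distr lborel borel ((+) x)) (B x)"
      by (simp add: lborel_distr_plus)
    also have "\<dots> = measure lborel ((+) x -` B x \<inter> space lborel)"
      by (subst measure_distr) auto
    also have "(+) x -` B x \<inter> space lborel = B0 x"
      by (auto simp: B_def B0_def)
    finally show ?thesis .
  qed
  \<comment> \<open>Translated to the fixed window \<open>{0..2}\<close>, the bad sets vanish
    pointwise in the limit, and the window itself supplies an integrable majorant.\<close>
  have "((\<lambda>x. \<integral>u. indicator (B0 x) u \<partial>lborel) \<longlongrightarrow> (\<integral>u. (0::real) \<partial>(lborel::real measure))) at_top"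
  proof (rule integral_dominated_convergence_at_top[where w = "indicator {0..2::real}"])
    show "integrable lborel (indicator {0..2} :: real \<Rightarrow> real)" by simp
    show "\<forall>\<^sub>F x in at_top. AE u in lborel. norm (indicator (B0 x) u :: real) \<le> indicator {0..2} u"
      by (auto simp: B0_def indicator_def)
    have "((\<lambda>x. indicator (B0 x) u :: real) \<longlongrightarrow> 0) at_top" for u
    proof -
      have "\<forall>\<^sub>F x in at_top. \<bar>h (x + u) - h x\<bar> < \<epsilon> / 2"
        using tendstoD[OF lim[of u], of "\<epsilon>/2"] \<open>\<epsilon> > 0\<close> by (simp add: dist_real_def)
      then have "\<forall>\<^sub>F x in at_top. (indicator (B0 x) u :: real) = 0"
        by eventually_elim (auto simp: B0_def)
      then show ?thesis by (rule tendsto_eventually)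
    qed
    then show "AE u in lborel. ((\<lambda>x. indicator (B0 x) u :: real) \<longlongrightarrow> 0) at_top" by simp
  qed auto
  then have "((\<lambda>x. measure lborel (B0 x)) \<longlongrightarrow> 0) at_top" by simp
  then have "\<forall>\<^sub>F x in at_top. measure lborel (B0 x) < 1/2"
    by (rule order_tendstoD) simp
  then obtain x0 where x0: "\<And>x. x \<ge> x0 \<Longrightarrow> measure lborel (B x) < 1/2"
    unfolding eventually_at_top_linorder B_shift by blast
  have fin: "B x \<in> fmeasurable lborel" for x
    by (rule fmeasurableI2[of "{x..x+2}"]) (auto simp: B_def fmeasurable_def)
  have "\<bar>h (x + c) - h x\<bar> \<le> \<epsilon>" if x: "x \<ge> x0" and c: "c \<in> {0..1}" for x c
  proof -
    \<comment> \<open>Since \<open>c\<close> is in \<open>{0..1}\<close>, this interval lies in both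
      windows \<open>{x..x+2}\<close> and \<open>{x+c..x+c+2}\<close>; its length 1 exceeds the
      total measure of the two bad sets.\<close>
    have "\<not> {x+1..x+2} \<subseteq> B x \<union> B (x + c)"
    proof
      assume sub: "{x+1..x+2} \<subseteq> B x \<union> B (x + c)"
      have "measure lborel {x+1..x+2} \<le> measure lborel (B x \<union> B (x + c))"
        by (rule measure_mono_fmeasurable[OF sub]) (auto intro: fmeasurable.Un fin)
      also have "\<dots> \<le> measure lborel (B x) + measure lborel (B (x + c))"
        by (rule measure_Un_le) auto
      also have "\<dots> < 1" using x0[of x] x0[of "x+c"] x c by simp
      finally show False by simp
    qed
    then obtain t where "t \<in> {x+1..x+2}" "t \<notin> B x" "t \<notin> B (x + c)" by blast
    then have "\<bar>h t - h x\<bar> \<le> \<epsilon>/2" "\<bar>h t - h (x+c)\<bar> \<le> \<epsilon>/2" using c by (auto simp: B_def)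
    then show ?thesis by linarith
  qed
  then show ?thesis by blast
qed

text \<open>In logarithmic coordinates, increments over shifts of length at most 1 are uniformly at
  most \<delta>, and they can be chained. Covering \<open>ln (y / x)\<close> takes at most
  \<open>1 + ln (y / x)\<close> such steps; exponentiating gives the constant
  \<open>exp \<delta>\<close> times a power of \<open>y / x\<close>.\<close>

lemma slowly_varying_Potter:
  assumes sv: "slowly_varying A L" and "\<delta> > 0"
  obtains x0 K where "x0 \<ge> A" "K \<ge> 1"
    "\<And>x y. x0 \<le> x \<Longrightarrow> x \<le> y \<Longrightarrow> L y \<le> K * (y / x) powr \<delta> * L x"
    "\<And>x y. x0 \<le> x \<Longrightarrow> x \<le> y \<Longrightarrow> L x \<le> K * (y / x) powr \<delta> * L y"
proof -
  have A: "A > 0" and pos: "\<And>x. x \<ge> A \<Longrightarrow> L x > 0"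
    and Lm: "L \<in> borel_measurable (restrict_space borel {A..})"
    and lim: "\<And>c. c > 0 \<Longrightarrow> ((\<lambda>x. L (c * x) / L x) \<longlongrightarrow> 1) at_top"
    using sv by (auto simp: slowly_varying_def)
  \<comment> \<open>\<open>L\<close> is measurable only for the trace sigma-algebra; setting it to 0
    below \<open>A\<close> gives a Borel function that agrees with it for large arguments.\<close>
  define L' where "L' x = indicator {A..} x * L x" for x
  have [measurable]: "L' \<in> borel_measurable borel"
    using Lm unfolding L'_def by (subst (asm) borel_measurable_restrict_space_iff) auto
  define h where "h x = ln (L' (exp x))" for x
  have [measurable]: "h \<in> borel_measurable borel" unfolding h_def by measurable
  have h: "h x = ln (L (exp x))" if "x \<ge> ln A" for x
    using that A by (simp add: h_def L'_def ln_ge_iff flip: ln_le_cancel_iff)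
  have pos': "L (exp x) > 0" if "x \<ge> ln A" for x
    by (rule pos) (metis A exp_le_cancel_iff exp_ln that)
  have hlim: "((\<lambda>x. h (x + u) - h x) \<longlongrightarrow> 0) at_top" for u
  proof -
    have "((\<lambda>x. L (exp u * exp x) / L (exp x)) \<longlongrightarrow> 1) at_top"
      by (rule filterlim_compose[OF lim[of "exp u"] exp_at_top]) simp
    then have "((\<lambda>x. ln (L (exp u * exp x) / L (exp x))) \<longlongrightarrow> ln 1) at_top"
      by (rule tendsto_ln) simp
    moreover have "\<forall>\<^sub>F x in at_top. ln (L (exp u * exp x) / L (exp x)) = h (x + u) - h x"
      using eventually_ge_at_top[of "ln A"] eventually_ge_at_top[of "ln A - u"]
    proof eventually_elim
      case (elim x)
      then have 1: "x + u \<ge> ln A" by simp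
      show ?case using h[OF elim(1)] h[OF 1] pos'[OF elim(1)] pos'[OF 1]
        by (simp add: ln_div exp_add mult.commute)
    qed
    ultimately have "((\<lambda>x. h (x + u) - h x) \<longlongrightarrow> ln 1) at_top"
      by (rule Lim_transform_eventually)
    then show ?thesis by simp
  qed
  obtain z where z: "\<And>x c. x \<ge> z \<Longrightarrow> 0 \<le> c \<Longrightarrow> c \<le> 1 \<Longrightarrow> \<bar>h (x + c) - h x\<bar> \<le> \<delta>"
    using slowly_varying_additive_uniform[OF _ hlim \<open>\<delta> > 0\<close>] by (auto simp: Ball_def)
  have step: "\<bar>h (x + c) - h x\<bar> \<le> \<delta> * real k" if "x \<ge> z" "0 \<le> c" "c \<le> real k" for x c k
    using that
  proof (induction k arbitrary: c)
    case 0 then show ?case by simp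
  next
    case (Suc k)
    show ?case
    proof (cases "c \<le> real k")
      case True
      then have "\<bar>h (x + c) - h x\<bar> \<le> \<delta> * real k" using Suc by simp
      also have "\<dots> \<le> \<delta> * real (Suc k)" using \<open>\<delta> > 0\<close> by simp
      finally show ?thesis .
    next
      case False
      define d where "d = c - real k"
      have "\<bar>h (x + real k) - h x\<bar> \<le> \<delta> * real k" using Suc by simp
      moreover have "\<bar>h ((x + real k) + d) - h (x + real k)\<bar> \<le> \<delta>"
        using False Suc.prems by (intro z) (auto simp: d_def)
      ultimately show ?thesis by (simp add: d_def algebra_simps)
    qed
  qed
  define x0 where "x0 = max A (exp z)"
  have *: "\<bar>ln (L y) - ln (L x)\<bar> \<le> \<delta> + \<delta> * ln (y / x)" if "x0 \<le> x" "x \<le> y" for x y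
  proof -
    have x: "x > 0" "x \<ge> A" "y \<ge> A" "y > 0" "x \<ge> exp z" using that A by (auto simp: x0_def)
    have lz: "ln x \<ge> z" using x(1,5) by (metis ln_exp ln_mono exp_gt_zero)
    have lA: "ln x \<ge> ln A" "ln y \<ge> ln A" using x A by auto
    define c where "c = ln (y / x)"
    have c0: "c \<ge> 0" using that x by (simp add: c_def)
    have cy: "ln x + c = ln y" using x by (simp add: c_def ln_div)
    have "\<bar>h (ln x + c) - h (ln x)\<bar> \<le> \<delta> * real (nat \<lceil>c\<rceil>)"
      by (rule step[OF lz c0]) (use c0 in linarith)
    also have "\<dots> \<le> \<delta> * (1 + c)" using \<open>\<delta> > 0\<close> c0 by (intro mult_left_mono) linarith+
    finally show ?thesis unfolding cy using h[OF lA(1)] h[OF lA(2)] x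
      by (simp add: c_def algebra_simps)
  qed
  show ?thesis
  proof (rule that[of x0 "exp \<delta>"])
    show "x0 \<ge> A" by (simp add: x0_def)
    show "exp \<delta> \<ge> 1" using \<open>\<delta> > 0\<close> by simp
  next
    fix x y assume xy: "x0 \<le> x" "x \<le> y"
    then have x: "x > 0" "L x > 0" "L y > 0" "y > 0" using A pos by (auto simp: x0_def)
    have e: "exp \<delta> * (y / x) powr \<delta> = exp (\<delta> + \<delta> * ln (y / x))"
      using x by (simp add: powr_def exp_add mult.commute)
    have "exp (ln (L y)) \<le> exp (\<delta> + \<delta> * ln (y / x) + ln (L x))"
      using *[OF xy] by (subst exp_le_cancel_iff) linarith
    then show "L y \<le> exp \<delta> * (y / x) powr \<delta> * L x"
      unfolding e using x by (simp add: exp_add)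
    have "exp (ln (L x)) \<le> exp (\<delta> + \<delta> * ln (y / x) + ln (L y))"
      using *[OF xy] by (subst exp_le_cancel_iff) linarith
    then show "L x \<le> exp \<delta> * (y / x) powr \<delta> * L y"
      unfolding e using x by (simp add: exp_add)
  qed
qed

section \<open>Norming by the de Bruijn conjugate\<close>

locale de_bruijn_norming =
  fixes A \<alpha> :: real and L Lt :: "real \<Rightarrow> real" and b :: "nat \<Rightarrow> real"
  assumes alpha: "1 \<le> \<alpha>" "\<alpha> < 2"
    and L: "slowly_varying A L"
    and Lt: "de_bruijn_conjugate A L Lt"
    and bounded_L: "bounded_on_intervals A L"
    and alpha_1: "\<alpha> = 1 \<Longrightarrow> (\<forall>x\<ge>A. L x \<ge> 1) \<and> mono_on {A..} L"
    and b: "\<And>n. n \<ge> 1 \<Longrightarrow> real n \<ge> A powr \<alpha> \<Longrightarrow>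
              b n = real n powr (1 / \<alpha>) * Lt (real n powr (1 / \<alpha>))"
begin

definition H :: "real \<Rightarrow> real" where "H t = t * L (t + A)"
definition G :: "real \<Rightarrow> real" where "G t = t powr \<alpha> * L (t + A) powr \<alpha>"

lemma A_pos: "A > 0" and L_pos: "x \<ge> A \<Longrightarrow> L x > 0"
  using L by (auto simp: slowly_varying_def)

lemma Lt_pos: "x \<ge> A \<Longrightarrow> Lt x > 0"
  using Lt by (auto simp: de_bruijn_conjugate_def slowly_varying_def)

lemma H_nonneg: "t \<ge> 0 \<Longrightarrow> H t \<ge> 0" and H_pos: "t > 0 \<Longrightarrow> H t > 0"
  using L_pos[of "t + A"] by (auto simp: H_def)

lemma G_nonneg: "G t \<ge> 0"
  by (simp add: G_def)

lemma G_eq: "t \<ge> 0 \<Longrightarrow> G t = H t powr \<alpha>"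
  using L_pos[of "t + A"] by (simp add: H_def G_def powr_mult)

lemma index_large:
  "\<forall>\<^sub>F n in sequentially. n \<ge> 1 \<and> real n \<ge> A powr \<alpha> \<and> real n powr (1 / \<alpha>) \<ge> A \<and>
     b n = real n powr (1 / \<alpha>) * Lt (real n powr (1 / \<alpha>))"
  using eventually_ge_at_top[of "1::nat"] eventually_ge_at_top[of "nat \<lceil>A powr \<alpha>\<rceil>"]
proof eventually_elim
  case (elim n)
  then have "real n \<ge> A powr \<alpha>" by linarith
  then have "real n powr (1 / \<alpha>) \<ge> (A powr \<alpha>) powr (1 / \<alpha>)" using alpha by (intro powr_mono2) auto
  then show ?case using elim alpha A_pos b[of n] \<open>real n \<ge> A powr \<alpha>\<close> by (simp add: powr_powr)
qed

lemma b_pos: "n \<ge> 1 \<Longrightarrow> real n \<ge> A powr \<alpha> \<Longrightarrow> b n > 0"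
proof -
  assume n: "n \<ge> 1" "real n \<ge> A powr \<alpha>"
  then have "real n powr (1 / \<alpha>) \<ge> (A powr \<alpha>) powr (1 / \<alpha>)" using alpha by (intro powr_mono2) auto
  then have "real n powr (1 / \<alpha>) \<ge> A" using alpha A_pos by (simp add: powr_powr)
  then show ?thesis using b[OF n] Lt_pos[of "real n powr (1 / \<alpha>)"] n by simp
qed

lemma root_at_top: "filterlim (\<lambda>n. real n powr (1 / \<alpha>)) at_top sequentially"
proof -
  have "filterlim (\<lambda>x::real. x powr (1 / \<alpha>)) at_top at_top"
    by (rule real_powr_at_top) (use alpha in auto)
  then show ?thesis by (rule filterlim_compose[OF _ filterlim_real_sequentially])
qed

text \<open>Potter's bound with exponent 1/2 keeps \<open>Lt y\<close> above a multiple of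
  \<open>y powr (-1/2)\<close>, so \<open>y * Lt y\<close> grows at least like the square root of
  \<open>y\<close>.\<close>

lemma b_at_top: "filterlim b at_top sequentially"
proof -
  have sv: "slowly_varying A Lt" using Lt by (simp add: de_bruijn_conjugate_def)
  obtain x0 K where P: "x0 \<ge> A" "K \<ge> 1"
    "\<And>x y. x0 \<le> x \<Longrightarrow> x \<le> y \<Longrightarrow> Lt x \<le> K * (y / x) powr (1/2) * Lt y"
    by (rule slowly_varying_Potter[OF sv, of "1/2"]) auto
  have x0: "x0 > 0" using P A_pos by simp
  define c where "c = Lt x0 * x0 powr (1/2) / K"
  have c: "c > 0" using Lt_pos[of x0] P x0 by (simp add: c_def)
  have low: "y * Lt y \<ge> c * y powr (1/2)" if "y \<ge> x0" for y
  proof -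
    have y: "y > 0" using that x0 by simp
    have "Lt x0 \<le> K * (y powr (1/2) / x0 powr (1/2)) * Lt y"
      using P(3)[of x0 y] that y x0 by (simp add: powr_divide)
    then have "c \<le> y powr (1/2) * Lt y" unfolding c_def using P(2) x0 by (simp add: field_simps)
    then have "c * y powr (1/2) \<le> y powr (1/2) * y powr (1/2) * Lt y"
      using mult_right_mono[of c "y powr (1/2) * Lt y" "y powr (1/2)"] by (simp add: mult.assoc mult.commute[of "Lt y"])
    also have "y powr (1/2) * y powr (1/2) = y" using y by (simp flip: powr_add)
    finally show ?thesis .
  qed
  have "filterlim (\<lambda>n. c * (real n powr (1 / \<alpha>)) powr (1/2)) at_top sequentially"
    by (intro filterlim_tendsto_pos_mult_at_top[OF tendsto_const c] filterlim_compose[OF real_powr_at_top root_at_top]) simp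
  moreover have "\<forall>\<^sub>F n in sequentially. c * (real n powr (1 / \<alpha>)) powr (1/2) \<le> b n"
    using index_large root_at_top[unfolded filterlim_at_top, rule_format, of x0]
  proof eventually_elim
    case (elim n)
    then show ?case using low[of "real n powr (1 / \<alpha>)"] by simp
  qed
  ultimately show ?thesis by (rule filterlim_at_top_mono)
qed

text \<open>This is the second conjugacy relation read along
  \<open>x = n powr (1 / \<alpha>)\<close>, where \<open>x * Lt x\<close> is exactly
  \<open>b n\<close> for large \<open>n\<close>.\<close>

lemma b_conjugate: "((\<lambda>n. b n * L (b n) / real n powr (1 / \<alpha>)) \<longlongrightarrow> 1) sequentially"
proof -
  have "((\<lambda>x. Lt x * L (x * Lt x)) \<longlongrightarrow> 1) at_top" using Lt by (simp add: de_bruijn_conjugate_def)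
  from filterlim_compose[OF this root_at_top]
  have 1: "((\<lambda>n. Lt (real n powr (1 / \<alpha>)) * L (real n powr (1 / \<alpha>) * Lt (real n powr (1 / \<alpha>)))) \<longlongrightarrow> 1)
      sequentially" .
  have "\<forall>\<^sub>F n in sequentially.
      Lt (real n powr (1 / \<alpha>)) * L (real n powr (1 / \<alpha>) * Lt (real n powr (1 / \<alpha>)))
      = b n * L (b n) / real n powr (1 / \<alpha>)"
    using index_large by eventually_elim simp
  with 1 show ?thesis by (rule Lim_transform_eventually)
qed

text \<open>The conjugate controls \<open>L\<close> at \<open>b n\<close>, whereas \<open>H\<close>
  evaluates it at \<open>b n + A\<close>. Potter's bound pays \<open>2 * K\<close> for this shift,
  and the limit 1 is relaxed to the range from 1/2 to 2; together these give \<open>4 * K\<close>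
  and its inverse.\<close>

lemma H_b:
  obtains c C where "c > 0" "C > 0"
    "\<forall>\<^sub>F n in sequentially. c * real n powr (1 / \<alpha>) \<le> H (b n) \<and> H (b n) \<le> C * real n powr (1 / \<alpha>)"
proof -
  obtain x0 K where P: "x0 \<ge> A" "K \<ge> 1"
    "\<And>x y. x0 \<le> x \<Longrightarrow> x \<le> y \<Longrightarrow> L y \<le> K * (y / x) powr 1 * L x"
    "\<And>x y. x0 \<le> x \<Longrightarrow> x \<le> y \<Longrightarrow> L x \<le> K * (y / x) powr 1 * L y"
    by (rule slowly_varying_Potter[OF L, of 1]) auto
  have sh: "L (x + A) \<le> 2 * K * L x \<and> L x \<le> 2 * K * L (x + A)" if "x \<ge> x0" for x
  proof -
    have x: "x > 0" "x \<ge> A" using that P A_pos by auto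
    have r: "(x + A) / x \<le> 2" "(x + A) / x \<ge> 0" using x A_pos by (auto simp: field_simps)
    have p: "L x > 0" "L (x + A) > 0" using L_pos x A_pos by auto
    have *: "K * ((x + A) / x) powr 1 \<le> 2 * K"
      using r P(2) mult_left_mono[OF r(1), of K] by (simp only: powr_one) simp
    have "L (x + A) \<le> K * ((x + A) / x) powr 1 * L x" "L x \<le> K * ((x + A) / x) powr 1 * L (x + A)"
      using P(3,4)[of x "x + A"] that A_pos by auto
    then show ?thesis using mult_right_mono[OF *, of "L x"] mult_right_mono[OF *, of "L (x + A)"] p by linarith
  qed
  have "\<forall>\<^sub>F n in sequentially. 1 / (4 * K) * real n powr (1 / \<alpha>) \<le> H (b n) \<and> H (b n) \<le> 4 * K * real n powr (1 / \<alpha>)"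
    using index_large b_at_top[unfolded filterlim_at_top, rule_format, of x0]
      order_tendstoD(1)[OF b_conjugate, of "1/2", simplified] order_tendstoD(2)[OF b_conjugate, of "2", simplified]
  proof eventually_elim
    case (elim n)
    define r where "r = real n powr (1 / \<alpha>)"
    have r: "r > 0" using elim by (simp add: r_def)
    have bn: "b n > 0" using elim P A_pos by simp
    have g: "r / 2 \<le> b n * L (b n)" "b n * L (b n) \<le> 2 * r"
      using elim r by (auto simp: field_simps simp flip: r_def)
    have "b n * L (b n + A) \<le> b n * (2 * K * L (b n))" "b n * L (b n) \<le> b n * (2 * K * L (b n + A))"
      using sh[of "b n"] elim(2) bn by (auto intro!: mult_left_mono simp del: elim)
    then have "H (b n) \<le> 2 * K * (b n * L (b n))" "b n * L (b n) \<le> 2 * K * H (b n)"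
      by (auto simp: H_def mult_ac)
    moreover have "2 * K * (b n * L (b n)) \<le> 2 * K * (2 * r)"
      using g P by (intro mult_left_mono) auto
    ultimately have "H (b n) \<le> 4 * K * r" "r / 2 \<le> 2 * K * H (b n)" using g by auto
    then show ?case using P by (auto simp: field_simps simp flip: r_def)
  qed
  then show ?thesis by (rule that[rotated 2]) (use P in auto)
qed

text \<open>Adding \<open>A\<close> to both arguments only brings their ratio closer to 1, so
  Potter's bounds for \<open>L\<close> carry over, and the factor \<open>t\<close> of
  \<open>H t\<close> contributes one more power of \<open>t / s\<close>. For \<delta> = 1 the lower
  bound has exponent 0: \<open>H\<close> is increasing up to a constant.\<close>

lemma H_Potter:
  assumes "\<delta> > 0"
  obtains x0 K where "x0 > 0" "K \<ge> 1"
    "\<And>s t. x0 \<le> s \<Longrightarrow> s \<le> t \<Longrightarrow> H t \<le> K * (t / s) powr (1 + \<delta>) * H s"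
    "\<And>s t. x0 \<le> s \<Longrightarrow> s \<le> t \<Longrightarrow> (t / s) powr (1 - \<delta>) * H s \<le> K * H t"
proof -
  obtain x0 K where P: "x0 \<ge> A" "K \<ge> 1"
    "\<And>x y. x0 \<le> x \<Longrightarrow> x \<le> y \<Longrightarrow> L y \<le> K * (y / x) powr \<delta> * L x"
    "\<And>x y. x0 \<le> x \<Longrightarrow> x \<le> y \<Longrightarrow> L x \<le> K * (y / x) powr \<delta> * L y"
    by (rule slowly_varying_Potter[OF L assms]) auto
  have *: "H t \<le> K * (t / s) powr (1 + \<delta>) * H s \<and> (t / s) powr (1 - \<delta>) * H s \<le> K * H t"
    if "x0 \<le> s" "s \<le> t" for s t
  proof -
    have st: "s > 0" "t > 0" using that P A_pos by auto
    have p: "L (s + A) > 0" "L (t + A) > 0" using L_pos st by auto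
    have q: "(t + A) / (s + A) \<le> t / s" using st A_pos that by (simp add: field_simps)
    have "((t + A) / (s + A)) powr \<delta> \<le> (t / s) powr \<delta>"
      by (rule powr_mono2) (use q assms st A_pos in auto)
    then have pw: "K * ((t + A) / (s + A)) powr \<delta> \<le> K * (t / s) powr \<delta>"
      using P by simp
    have "L (t + A) \<le> K * (t / s) powr \<delta> * L (s + A)" "L (s + A) \<le> K * (t / s) powr \<delta> * L (t + A)"
      using P(3,4)[of "s + A" "t + A"] that A_pos mult_right_mono[OF pw, of "L (s + A)"]
        mult_right_mono[OF pw, of "L (t + A)"] p by auto
    moreover define u v where "u = (t / s) powr \<delta>" and "v = (t / s) powr (1 - \<delta>)"
    ultimately have L1: "L (t + A) \<le> K * u * L (s + A)" and L2: "L (s + A) \<le> K * u * L (t + A)" by auto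
    have uv: "v * u = t / s" "v \<ge> 0" using st by (simp_all add: u_def v_def flip: powr_add)
    have e: "(t / s) powr (1 + \<delta>) = t / s * u" using st by (simp add: powr_add u_def)
    have "H t \<le> t * (K * u * L (s + A))" unfolding H_def using L1 st by (intro mult_left_mono) auto
    also have "\<dots> = K * (t / s * u) * H s" using st by (simp add: H_def)
    finally have 1: "H t \<le> K * (t / s) powr (1 + \<delta>) * H s" by (simp only: e)
    have "v * H s = v * s * L (s + A)" by (simp add: H_def)
    also have "\<dots> \<le> v * s * (K * u * L (t + A))" using L2 st uv by (intro mult_left_mono) auto
    also have "\<dots> = (v * u) * s * (K * L (t + A))" by (simp only: mult_ac)
    also have "\<dots> = K * H t" using st by (simp add: H_def uv)
    finally show ?thesis using 1 by (simp add: v_def)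
  qed
  show ?thesis by (rule that[of x0 K]) (use P A_pos * in auto)
qed

section \<open>Pointwise comparison of \<open>G t\<close> with the index \<open>n\<close>\<close>

text \<open>Below a large level \<open>x0\<close> regular variation says nothing, and boundedness on intervals is used.\<close>
lemma H_bounded:
  obtains B where "B > 0" "\<And>t. 0 \<le> t \<Longrightarrow> t \<le> x \<Longrightarrow> H t \<le> B"
proof -
  have "bounded (L ` {A..\<bar>x\<bar> + A})"
    using bounded_L unfolding bounded_on_intervals_def by auto
  then obtain B where B: "\<And>y. y \<in> {A..\<bar>x\<bar> + A} \<Longrightarrow> \<bar>L y\<bar> \<le> B" unfolding bounded_iff by (metis imageI real_norm_def)
  have "H t \<le> \<bar>x\<bar> * \<bar>B\<bar> + 1" if "0 \<le> t" "t \<le> x" for t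
  proof -
    have "L (t + A) \<le> \<bar>B\<bar>" using B[of "t + A"] that by auto
    then have "t * L (t + A) \<le> \<bar>x\<bar> * \<bar>B\<bar>" using that L_pos[of "t + A"] by (intro mult_mono) auto
    then show ?thesis by (simp add: H_def)
  qed
  then show ?thesis by (rule that[rotated]) (auto intro: add_nonneg_pos)
qed

text \<open>Serves the necessity part: any large index \<open>n\<close> with
  \<open>t \<le> b n\<close> bounds \<open>G t\<close>, so \<open>G t\<close> can be estimated by
  counting the indices with \<open>b n < t\<close>.\<close>

lemma G_le_of_le_b:
  obtains C where "C > 0" "\<forall>\<^sub>F n in sequentially. \<forall>t. 0 \<le> t \<and> t \<le> b n \<longrightarrow> G t \<le> C * real n"
proof -
  obtain c C where HB: "c > 0" "C > 0"
    "\<forall>\<^sub>F n in sequentially. c * real n powr (1 / \<alpha>) \<le> H (b n) \<and> H (b n) \<le> C * real n powr (1 / \<alpha>)"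
    by (rule H_b) blast
  \<comment> \<open>With exponent 0 the power disappears, leaving \<open>H s \<le> K * H t\<close>
    above the level \<open>x0\<close>.\<close>
  obtain x0 K where P: "x0 > 0" "K \<ge> 1"
    "\<And>s t. x0 \<le> s \<Longrightarrow> s \<le> t \<Longrightarrow> (t / s) powr (1 - 1) * H s \<le> K * H t"
    by (rule H_Potter[of 1]) auto
  obtain B where B: "B > 0" "\<And>t. 0 \<le> t \<Longrightarrow> t \<le> x0 \<Longrightarrow> H t \<le> B" by (rule H_bounded[of x0]) blast
  define D where "D = max B (K * C)"
  have "\<forall>\<^sub>F n in sequentially. \<forall>t. 0 \<le> t \<and> t \<le> b n \<longrightarrow> G t \<le> D powr \<alpha> * real n"
    using HB(3) index_large
  proof eventually_elim
    case (elim n)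
    show ?case
    proof (intro allI impI)
      fix t assume t: "0 \<le> t \<and> t \<le> b n"
      have r: "real n powr (1 / \<alpha>) \<ge> 1" using elim alpha by (simp add: ge_one_powr_ge_zero)
      have "H t \<le> D * real n powr (1 / \<alpha>)"
      proof (cases "t \<le> x0")
        case True
        then have "H t \<le> D" using B(2)[of t] t by (simp add: D_def)
        also have "D \<le> D * real n powr (1 / \<alpha>)" using r B(1) mult_left_mono[OF r, of D] by (simp add: D_def)
        finally show ?thesis .
      next
        case False
        then have "H t \<le> K * H (b n)" using P(3)[of t "b n"] t P(1) by auto
        also have "\<dots> \<le> K * (C * real n powr (1 / \<alpha>))" using elim P by (intro mult_left_mono) auto
        also have "\<dots> = (K * C) * real n powr (1 / \<alpha>)" by simp
        also have "\<dots> \<le> D * real n powr (1 / \<alpha>)" by (intro mult_right_mono) (auto simp: D_def)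
        finally show ?thesis .
      qed
      then have "H t powr \<alpha> \<le> (D * real n powr (1 / \<alpha>)) powr \<alpha>"
        using H_nonneg[of t] t alpha by (intro powr_mono2) auto
      also have "\<dots> = D powr \<alpha> * real n"
        using B(1) alpha elim by (simp add: powr_mult powr_powr D_def)
      finally show "G t \<le> D powr \<alpha> * real n" using G_eq t by simp
    qed
  qed
  then show ?thesis by (rule that[rotated]) (use B in \<open>simp add: D_def\<close>)
qed

text \<open>The exponent \<open>p > 1\<close> is the point: it makes the sum over \<open>n\<close>
  converge. For \<open>t \<le> b n\<close> Potter's bound estimates \<open>t / b n\<close> by a
  power of \<open>H t\<close>; for \<open>t > b n\<close> the right side is bounded below by near
  monotonicity of \<open>H\<close>. The summand 1 next to \<open>G t\<close> takes care of small
  \<open>t\<close>, where regular variation gives no comparison.\<close>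

lemma truncated_square_le:
  obtains p C where "p > 1" "C > 0"
    "\<forall>\<^sub>F n in sequentially. \<forall>t\<ge>0. min 1 ((t / b n)\<^sup>2) \<le> C * ((1 + G t) / real n) powr p"
proof -
  \<comment> \<open>\<delta> is half of the room \<open>2 / \<alpha> - 1\<close> left by \<alpha> <
    2, and \<open>p\<close> is chosen so that \<open>(1 + \<delta>) * (\<alpha> * p) = 2\<close>:
    Potter's bound raised to the power \<open>\<alpha> * p\<close> then produces exactly the
    square.\<close>
  define \<delta> where "\<delta> = (2 / \<alpha> - 1) / 2"
  define p where "p = 2 / (\<alpha> * (1 + \<delta>))"
  have d: "\<delta> > 0" using alpha by (simp add: \<delta>_def)
  have "\<alpha> * (1 + \<delta>) = 1 + \<alpha> / 2" using alpha by (simp add: \<delta>_def field_simps)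
  then have p: "p > 1" using alpha by (simp add: p_def)
  obtain c C where HB: "c > 0" "C > 0"
    "\<forall>\<^sub>F n in sequentially. c * real n powr (1 / \<alpha>) \<le> H (b n) \<and> H (b n) \<le> C * real n powr (1 / \<alpha>)"
    by (rule H_b) blast
  obtain x0 K where P: "x0 > 0" "K \<ge> 1"
    "\<And>s t. x0 \<le> s \<Longrightarrow> s \<le> t \<Longrightarrow> H t \<le> K * (t / s) powr (1 + \<delta>) * H s"
    by (rule H_Potter[OF d]) auto
  obtain x1 K1 where P1: "x1 > 0" "K1 \<ge> 1"
    "\<And>s t. x1 \<le> s \<Longrightarrow> s \<le> t \<Longrightarrow> (t / s) powr (1 - 1) * H s \<le> K1 * H t"
    by (rule H_Potter[of 1]) auto
  define x2 where "x2 = max x0 x1"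
  define D where "D = max K K1 / c"
  have D: "D > 0" using P HB by (simp add: D_def)
  define E where "E = D powr (\<alpha> * p) * (1 + G x2) powr p"
  have E: "D powr (\<alpha> * p) \<le> E" "E > 0"
  proof -
    have g: "(1 + G x2) powr p \<ge> 1" using G_nonneg[of x2] p by (intro ge_one_powr_ge_zero) auto
    show "D powr (\<alpha> * p) \<le> E" unfolding E_def using mult_left_mono[OF g, of "D powr (\<alpha> * p)"] by simp
    moreover have "D powr (\<alpha> * p) > 0" using D by simp
    ultimately show "E > 0" by linarith
  qed
  have "\<forall>\<^sub>F n in sequentially. \<forall>t\<ge>0. min 1 ((t / b n)\<^sup>2) \<le> E * ((1 + G t) / real n) powr p"
    using HB(3) index_large b_at_top[unfolded filterlim_at_top, rule_format, of x2]
  proof eventually_elim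
    case (elim n)
    have n: "real n > 0" using elim by simp
    have bn: "b n \<ge> x2" "b n > 0" using elim P by (auto simp: x2_def)
    have key: "min 1 ((t / b n)\<^sup>2) \<le> D powr (\<alpha> * p) * (G t / real n) powr p" if t: "t \<ge> x2" for t
    proof -
      have t0: "t > 0" using t P by (auto simp: x2_def)
      have eq: "(D * (H t / real n powr (1 / \<alpha>))) powr (\<alpha> * p) = D powr (\<alpha> * p) * (G t / real n) powr p"
      proof -
        have "(H t / real n powr (1 / \<alpha>)) powr \<alpha> = G t / real n"
          using H_pos[OF t0] n alpha t0 by (simp add: powr_divide powr_powr G_eq)
        then have "(G t / real n) powr p = (H t / real n powr (1 / \<alpha>)) powr (\<alpha> * p)"
          by (metis powr_powr)
        then show ?thesis using D H_pos[OF t0] n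
          by (subst powr_mult) auto
      qed
      show ?thesis
      proof (cases "t \<le> b n")
        case True
        have "c * real n powr (1 / \<alpha>) \<le> K * (b n / t) powr (1 + \<delta>) * H t"
          using P(3)[of t "b n"] t True elim by (auto simp: x2_def)
        also have "\<dots> \<le> max K K1 * (b n / t) powr (1 + \<delta>) * H t"
          using H_pos[OF t0] by (intro mult_right_mono) auto
        finally have "1 \<le> D * (b n / t) powr (1 + \<delta>) * H t / real n powr (1 / \<alpha>)"
          using HB n by (simp add: D_def field_simps)
        then have "(t / b n) powr (1 + \<delta>) * 1 \<le> (t / b n) powr (1 + \<delta>) * (D * (b n / t) powr (1 + \<delta>) * H t / real n powr (1 / \<alpha>))"
          by (intro mult_left_mono) auto
        also have "\<dots> = ((t / b n) powr (1 + \<delta>) * (b n / t) powr (1 + \<delta>)) * (D * (H t / real n powr (1 / \<alpha>)))"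
          by (simp add: mult_ac)
        also have "(t / b n) powr (1 + \<delta>) * (b n / t) powr (1 + \<delta>) = 1"
          using t0 bn by (simp flip: powr_mult)
        finally have "(t / b n) powr (1 + \<delta>) \<le> D * (H t / real n powr (1 / \<alpha>))" by simp
        then have "((t / b n) powr (1 + \<delta>)) powr (\<alpha> * p) \<le> (D * (H t / real n powr (1 / \<alpha>))) powr (\<alpha> * p)"
          using alpha p by (intro powr_mono2) auto
        moreover have "((t / b n) powr (1 + \<delta>)) powr (\<alpha> * p) = (t / b n)\<^sup>2"
        proof -
          have "(1 + \<delta>) * (\<alpha> * p) = 2" using alpha d by (simp add: p_def divide_simps)
          then show ?thesis using t0 bn by (simp add: powr_powr)
        qed
        ultimately show ?thesis using eq by simp
      next
        case False
        have "c * real n powr (1 / \<alpha>) \<le> H (b n)" using elim by simp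
        also have "\<dots> \<le> K1 * H t"
          using P1(3)[of "b n" t] False bn t0 by (auto simp: x2_def)
        also have "\<dots> \<le> max K K1 * H t" using H_pos[OF t0] by (intro mult_right_mono) auto
        finally have "1 \<le> D * (H t / real n powr (1 / \<alpha>))" using HB n by (simp add: D_def field_simps)
        then have "1 \<le> (D * (H t / real n powr (1 / \<alpha>))) powr (\<alpha> * p)"
          using alpha p by (intro ge_one_powr_ge_zero) auto
        then show ?thesis using eq by simp
      qed
    qed
    show ?case
    proof (intro allI impI)
      fix t :: real assume t: "t \<ge> 0"
      show "min 1 ((t / b n)\<^sup>2) \<le> E * ((1 + G t) / real n) powr p"
      proof (cases "t \<ge> x2")
        case True
        have "D powr (\<alpha> * p) * (G t / real n) powr p \<le> E * ((1 + G t) / real n) powr p"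
          using E G_nonneg[of t] p n by (intro mult_mono powr_mono2 divide_right_mono) auto
        then show ?thesis using key[OF True] by linarith
      next
        case False
        \<comment> \<open>Below the threshold the left side is at most its value at
          \<open>x2\<close>, where \<open>key\<close> applies; the factor in \<open>E\<close>
          absorbs \<open>G x2\<close>.\<close>
        have "min 1 ((t / b n)\<^sup>2) \<le> min 1 ((x2 / b n)\<^sup>2)"
          using False t bn by (intro min.mono power_mono divide_right_mono) auto
        also have "\<dots> \<le> D powr (\<alpha> * p) * (G x2 / real n) powr p" by (rule key) simp
        also have "\<dots> \<le> D powr (\<alpha> * p) * ((1 + G x2) * ((1 + G t) / real n)) powr p"
        proof (intro mult_left_mono powr_mono2)
          have "G x2 \<le> (1 + G x2) * (1 + G t)" using G_nonneg[of x2] G_nonneg[of t] by (simp add: algebra_simps)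
          then show "G x2 / real n \<le> (1 + G x2) * ((1 + G t) / real n)" using n by (simp add: field_simps)
        qed (use p G_nonneg in auto)
        also have "\<dots> = E * ((1 + G t) / real n) powr p"
          unfolding E_def mult.assoc using G_nonneg[of x2] G_nonneg[of t] by (subst powr_mult) auto
        finally show ?thesis .
      qed
    qed
  qed
  then show ?thesis using p E by (intro that[of p E])
qed

text \<open>Controls the first moment beyond the truncation level, multiplied by
  \<open>n / b n\<close>. As \<open>G\<close> is the power \<alpha> of \<open>H\<close>, what must
  be gained from \<open>H\<close> is exactly the power \<open>1 / \<alpha>\<close> of
  \<open>t / b n\<close>.\<close>

lemma tail_le:
  obtains C where "C > 0" "\<forall>\<^sub>F n in sequentially. \<forall>t. t > b n \<longrightarrow> real n * t / b n \<le> C * G t"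
proof -
  obtain c C where HB: "c > 0" "C > 0"
    "\<forall>\<^sub>F n in sequentially. c * real n powr (1 / \<alpha>) \<le> H (b n) \<and> H (b n) \<le> C * real n powr (1 / \<alpha>)"
    by (rule H_b) blast
  \<comment> \<open>For \<alpha> > 1 the loss \<delta> = 1 - 1 / \<alpha> in Potter's bound leaves
    exactly the required exponent. For \<alpha> = 1 no loss is allowed, and monotonicity of
    \<open>L\<close> gives the bound with constant 1.\<close>
  obtain x0 K where P: "K > 0"
    "\<And>s t. x0 \<le> s \<Longrightarrow> s \<le> t \<Longrightarrow> s > 0 \<Longrightarrow> (t / s) powr (1 / \<alpha>) * H s \<le> K * H t"
  proof (cases "\<alpha> = 1")
    case True
    have *: "(t / s) powr (1 / \<alpha>) * H s \<le> 1 * H t" if "s \<le> t" "s > 0" for s t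
    proof -
      have "L (s + A) \<le> L (t + A)" using alpha_1[OF True] that A_pos by (auto simp: mono_on_def)
      then show ?thesis using that True by (simp add: H_def)
    qed
    show ?thesis by (rule that[of 1]) (use * in auto)
  next
    case False
    then have "1 - 1 / \<alpha> > 0" using alpha by simp
    then obtain x0 K where "K \<ge> 1"
      "\<And>s t. x0 \<le> s \<Longrightarrow> s \<le> t \<Longrightarrow> (t / s) powr (1 - (1 - 1 / \<alpha>)) * H s \<le> K * H t"
      by (rule H_Potter) auto
    then show ?thesis by (intro that[of K x0]) auto
  qed
  have "\<forall>\<^sub>F n in sequentially. \<forall>t. t > b n \<longrightarrow> real n * t / b n \<le> (K / c) powr \<alpha> * G t"
    using HB(3) index_large b_at_top[unfolded filterlim_at_top, rule_format, of "max 1 x0"]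
  proof eventually_elim
    case (elim n)
    show ?case
    proof (intro allI impI)
      fix t assume t: "t > b n"
      have bn: "b n > 0" and t0: "t > 0" using elim t by auto
      have "(t / b n) powr (1 / \<alpha>) * (c * real n powr (1 / \<alpha>)) \<le> (t / b n) powr (1 / \<alpha>) * H (b n)"
        using elim by (intro mult_left_mono) auto
      also have "\<dots> \<le> K * H t" using P(2)[of "b n" t] elim t bn by auto
      finally have "(t / b n) powr (1 / \<alpha>) * real n powr (1 / \<alpha>) \<le> K / c * H t"
        using HB by (simp add: field_simps)
      then have "(t / b n * real n) powr (1 / \<alpha>) \<le> K / c * H t"
        using t0 bn by (subst powr_mult) auto
      then have "((t / b n * real n) powr (1 / \<alpha>)) powr \<alpha> \<le> (K / c * H t) powr \<alpha>"
        using alpha by (intro powr_mono2) auto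
      also have "((t / b n * real n) powr (1 / \<alpha>)) powr \<alpha> = t / b n * real n"
        using t0 bn alpha by (simp add: powr_powr)
      also have "(K / c * H t) powr \<alpha> = (K / c) powr \<alpha> * G t"
        using H_pos[OF t0] P(1) HB(1) t0 by (subst powr_mult) (auto simp: G_eq)
      finally show "real n * t / b n \<le> (K / c) powr \<alpha> * G t" by (simp add: mult_ac)
    qed
  qed
  then show ?thesis by (rule that[rotated]) (use P HB in simp)
qed

text \<open>Shows that a drift of order \<open>n\<close> is not negligible against
  \<open>b n\<close>. For \<alpha> = 1 the bound \<open>L \<ge> 1\<close> gives
  \<open>b n \<le> b n * L (b n)\<close>; for \<alpha> > 1 Potter's bound for \<open>Lt\<close> may
  lose the power \<alpha> - 1 and still ends at \<open>y powr \<alpha> = n\<close>.\<close>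

lemma b_le_linear:
  obtains C where "C > 0" "\<forall>\<^sub>F n in sequentially. b n \<le> C * real n"
proof (cases "\<alpha> = 1")
  case True
  have "((\<lambda>n. b n * L (b n) / real n) \<longlongrightarrow> 1) sequentially"
    using b_conjugate True by simp
  then have "\<forall>\<^sub>F n in sequentially. b n * L (b n) / real n < 2" by (rule order_tendstoD) simp
  then have "\<forall>\<^sub>F n in sequentially. b n \<le> 2 * real n"
    using index_large b_at_top[unfolded filterlim_at_top, rule_format, of "A"]
  proof eventually_elim
    case (elim n)
    have "L (b n) \<ge> 1" using alpha_1[OF True] elim by auto
    then have "b n * 1 \<le> b n * L (b n)" using elim A_pos by (intro mult_left_mono) auto
    also have "\<dots> \<le> 2 * real n" using elim by (simp add: field_simps)
    finally show ?case by simp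
  qed
  then show ?thesis by (rule that[rotated]) simp
next
  case False
  have sv: "slowly_varying A Lt" using Lt by (simp add: de_bruijn_conjugate_def)
  have "\<alpha> - 1 > 0" using False alpha by simp
  then obtain x0 K where P: "x0 \<ge> A" "K \<ge> 1"
    "\<And>x y. x0 \<le> x \<Longrightarrow> x \<le> y \<Longrightarrow> Lt y \<le> K * (y / x) powr (\<alpha> - 1) * Lt x"
    by (rule slowly_varying_Potter[OF sv]) auto
  have x0: "x0 > 0" using P A_pos by simp
  define C where "C = K * Lt x0 / x0 powr (\<alpha> - 1)"
  have C: "C > 0" using P x0 Lt_pos[of x0] by (simp add: C_def)
  have "\<forall>\<^sub>F n in sequentially. b n \<le> C * real n"
    using index_large root_at_top[unfolded filterlim_at_top, rule_format, of x0]
  proof eventually_elim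
    case (elim n)
    define y where "y = real n powr (1 / \<alpha>)"
    have y: "y \<ge> x0" "y > 0" using elim x0 by (auto simp: y_def)
    have "b n = y * Lt y" using elim by (simp add: y_def)
    also have "\<dots> \<le> y * (K * (y / x0) powr (\<alpha> - 1) * Lt x0)"
      using P(3)[of x0 y] y by (intro mult_left_mono) auto
    also have "\<dots> = C * (y * y powr (\<alpha> - 1))"
      using y x0 by (simp add: C_def powr_divide)
    also have "y * y powr (\<alpha> - 1) = y powr \<alpha>" using y by (simp add: powr_diff)
    also have "\<dots> = real n" using alpha elim by (simp add: y_def powr_powr)
    finally show ?case .
  qed
  then show ?thesis using C by (intro that[of C])
qed

text \<open>A substitute for monotonicity of \<open>b\<close> when passing between powers of two and
  the indices between them. Up to \<open>2 * n\<close> the root changes by a factor at most 2 and,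
  by Potter's bound, \<open>Lt\<close> by a factor at most \<open>2 * K\<close>.\<close>

lemma b_comparable:
  obtains C where "C > 0"
    "\<forall>\<^sub>F n in sequentially. \<forall>m. n \<le> m \<and> m \<le> 2 * n \<longrightarrow> b m \<le> C * b n \<and> b n \<le> C * b m"
proof -
  have sv: "slowly_varying A Lt" using Lt by (simp add: de_bruijn_conjugate_def)
  obtain x0 K where P: "x0 \<ge> A" "K \<ge> 1"
    "\<And>x y. x0 \<le> x \<Longrightarrow> x \<le> y \<Longrightarrow> Lt y \<le> K * (y / x) powr 1 * Lt x"
    "\<And>x y. x0 \<le> x \<Longrightarrow> x \<le> y \<Longrightarrow> Lt x \<le> K * (y / x) powr 1 * Lt y"
    by (rule slowly_varying_Potter[OF sv, of 1]) auto
  obtain n0 where n0: "\<And>n. n \<ge> n0 \<Longrightarrow> n \<ge> 1 \<and> b n = real n powr (1 / \<alpha>) * Lt (real n powr (1 / \<alpha>)) \<and> real n powr (1 / \<alpha>) \<ge> x0"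
    using eventually_conj[OF index_large root_at_top[unfolded filterlim_at_top, rule_format, of x0]]
    unfolding eventually_sequentially by blast
  have "b m \<le> 4 * K * b n \<and> b n \<le> 4 * K * b m" if "n \<ge> n0" "n \<le> m" "m \<le> 2 * n" for n m
  proof -
    define x where "x = real n powr (1 / \<alpha>)"
    define y where "y = real m powr (1 / \<alpha>)"
    have xy: "x \<ge> x0" "x \<le> y" "n \<ge> 1"
      using n0[of n] that alpha by (auto simp: x_def y_def intro!: powr_mono2)
    have x: "x > 0" "y > 0" using xy P A_pos by auto
    have "y / x = (real m / real n) powr (1 / \<alpha>)" using that xy by (simp add: x_def y_def powr_divide)
    also have "\<dots> \<le> 2 powr (1 / \<alpha>)" using that xy alpha by (intro powr_mono2) (auto simp: field_simps)
    also have "\<dots> \<le> 2 powr 1" using alpha by (intro powr_mono) auto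
    finally have r: "y / x \<le> 2" by simp
    have l: "Lt x > 0" "Lt y > 0" using Lt_pos xy P by auto
    have y2: "y \<le> 2 * x" using r x by (simp add: field_simps)
    have *: "K * (y / x) powr 1 \<le> 2 * K" using r x P mult_left_mono[OF r, of K] by simp
    have "Lt y \<le> 2 * K * Lt x" "Lt x \<le> 2 * K * Lt y"
      using P(3,4)[OF xy(1,2)] mult_right_mono[OF *, of "Lt x"] mult_right_mono[OF *, of "Lt y"] l by auto
    then have "y * Lt y \<le> (2 * x) * (2 * K * Lt x)" "x * Lt x \<le> y * (2 * K * Lt y)"
      using mult_mono[of y "2 * x" "Lt y" "2 * K * Lt x"] mult_mono[of x y "Lt x" "2 * K * Lt y"] y2 x l xy by auto
    moreover have "b n = x * Lt x" "b m = y * Lt y" using n0[of n] n0[of m] that by (auto simp: x_def y_def)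
    moreover have "K * (y * Lt y) \<ge> 0" using P x l by simp
    ultimately show ?thesis by (auto simp: algebra_simps)
  qed
  then show ?thesis by (intro that[of "4 * K"]) (use P in \<open>auto simp: eventually_sequentially\<close>)
qed

end

section \<open>Negative association\<close>

lemma (in prob_space) covariance_eq:
  assumes "covariance_exists M U V"
  shows "covariance M U V = expectation (\<lambda>\<omega>. U \<omega> * V \<omega>) - expectation U * expectation V"
proof -
  have [simp]: "integrable M U" "integrable M V" "integrable M (\<lambda>\<omega>. U \<omega> * V \<omega>)"
    using assms by (auto simp: covariance_exists_def)
  have "covariance M U V = expectation (\<lambda>\<omega>. U \<omega> * V \<omega> - expectation V * U \<omega> - expectation U * V \<omega>
      + expectation U * expectation V)"
    unfolding covariance_def by (rule Bochner_Integration.integral_cong) (auto simp: algebra_simps)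
  also have "\<dots> = expectation (\<lambda>\<omega>. U \<omega> * V \<omega>) - expectation U * expectation V"
    by (simp add: prob_space)
  finally show ?thesis .
qed

text \<open>The monotonicity hypotheses force \<open>F\<close> and \<open>G\<close> to depend on the coordinates in \<open>I\<close>
  and \<open>J\<close> only, which avoids extensional functions.\<close>
lemma (in prob_space) neg_associated_expectation_le:
  fixes F G :: "('i \<Rightarrow> real) \<Rightarrow> real"
  assumes NA: "neg_associated M X T"
    and IJ: "finite I" "finite J" "I \<subseteq> T" "J \<subseteq> T" "I \<inter> J = {}"
    and F: "\<And>x y. (\<And>i. i \<in> I \<Longrightarrow> x i \<le> y i) \<Longrightarrow> F x \<le> F y"
    and G: "\<And>x y. (\<And>i. i \<in> J \<Longrightarrow> x i \<le> y i) \<Longrightarrow> G x \<le> G y"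
    and int: "integrable M (\<lambda>\<omega>. F (\<lambda>i. X i \<omega>))" "integrable M (\<lambda>\<omega>. G (\<lambda>i. X i \<omega>))"
      "integrable M (\<lambda>\<omega>. F (\<lambda>i. X i \<omega>) * G (\<lambda>i. X i \<omega>))"
  shows "expectation (\<lambda>\<omega>. F (\<lambda>i. X i \<omega>) * G (\<lambda>i. X i \<omega>))
    \<le> expectation (\<lambda>\<omega>. F (\<lambda>i. X i \<omega>)) * expectation (\<lambda>\<omega>. G (\<lambda>i. X i \<omega>))"
proof -
  have FI: "F (\<lambda>k\<in>I. x k) = F x" for x by (rule antisym) (auto intro!: F)
  have GJ: "G (\<lambda>k\<in>J. x k) = G x" for x by (rule antisym) (auto intro!: G)
  have "neg_associated_fin M X (I \<union> J)"
    using NA IJ by (auto simp: neg_associated_def)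
  moreover have "coordwise_nondecreasing I F" "coordwise_nondecreasing J G"
    using F G by (auto simp: coordwise_nondecreasing_def)
  moreover have "covariance_exists M (\<lambda>\<omega>. F (\<lambda>k\<in>I. X k \<omega>)) (\<lambda>\<omega>. G (\<lambda>k\<in>J. X k \<omega>))"
    using int by (simp add: covariance_exists_def FI GJ)
  ultimately have "covariance M (\<lambda>\<omega>. F (\<lambda>k\<in>I. X k \<omega>)) (\<lambda>\<omega>. G (\<lambda>k\<in>J. X k \<omega>)) \<le> 0"
    using IJ(5) unfolding neg_associated_fin_def by blast
  with covariance_eq[of "\<lambda>\<omega>. F (\<lambda>k\<in>I. X k \<omega>)" "\<lambda>\<omega>. G (\<lambda>k\<in>J. X k \<omega>)"] int show ?thesis
    by (simp add: covariance_exists_def FI GJ)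
qed

text \<open>Monotone maps can be moved into the test functions. Nonnegative weights, clipping and
  centring are all of this kind.\<close>

lemma neg_associated_comp_mono:
  fixes X :: "'i \<Rightarrow> 'a \<Rightarrow> real" and \<phi> :: "'i \<Rightarrow> real \<Rightarrow> real"
  assumes NA: "neg_associated M X T" and mono: "\<And>i. i \<in> T \<Longrightarrow> mono (\<phi> i)"
  shows "neg_associated M (\<lambda>i \<omega>. \<phi> i (X i \<omega>)) T"
  unfolding neg_associated_def neg_associated_fin_def
proof (intro allI impI, elim conjE)
  fix S I J and f g :: "('i \<Rightarrow> real) \<Rightarrow> real"
  assume S: "finite S" "S \<subseteq> T" and IJ: "I \<subseteq> S" "J \<subseteq> S" "I \<inter> J = {}"
    and fg: "coordwise_nondecreasing I f" "coordwise_nondecreasing J g"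
    and c: "covariance_exists M (\<lambda>\<omega>. f (\<lambda>k\<in>I. \<phi> k (X k \<omega>))) (\<lambda>\<omega>. g (\<lambda>k\<in>J. \<phi> k (X k \<omega>)))"
  define f' where "f' x = f (\<lambda>k\<in>I. \<phi> k (x k))" for x
  define g' where "g' x = g (\<lambda>k\<in>J. \<phi> k (x k))" for x
  have 1: "f' (\<lambda>k\<in>I. x k) = f (\<lambda>k\<in>I. \<phi> k (x k))" "g' (\<lambda>k\<in>J. x k) = g (\<lambda>k\<in>J. \<phi> k (x k))" for x
    unfolding f'_def g'_def by (auto intro!: arg_cong[of _ _ f] arg_cong[of _ _ g])
  have "coordwise_nondecreasing I f'" "coordwise_nondecreasing J g'"
    using fg S IJ mono unfolding coordwise_nondecreasing_def f'_def g'_def mono_def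
    by (auto simp: PiE_def Pi_def extensional_def subset_iff)
  moreover have "neg_associated_fin M X S" using NA S by (auto simp: neg_associated_def)
  ultimately have "covariance M (\<lambda>\<omega>. f' (\<lambda>k\<in>I. X k \<omega>)) (\<lambda>\<omega>. g' (\<lambda>k\<in>J. X k \<omega>)) \<le> 0"
    using IJ c unfolding neg_associated_fin_def 1[symmetric] by blast
  then show "covariance M (\<lambda>\<omega>. f (\<lambda>k\<in>I. \<phi> k (X k \<omega>))) (\<lambda>\<omega>. g (\<lambda>k\<in>J. \<phi> k (X k \<omega>))) \<le> 0"
    by (simp only: 1)
qed

text \<open>Reflecting the arguments turns a nondecreasing test function into a nonincreasing one; a
  second sign in front repairs this, and the two outer signs cancel in the covariance.\<close>

lemma neg_associated_uminus:
  fixes X :: "'i \<Rightarrow> 'a \<Rightarrow> real"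
  assumes NA: "neg_associated M X T"
  shows "neg_associated M (\<lambda>i \<omega>. - X i \<omega>) T"
  unfolding neg_associated_def neg_associated_fin_def
proof (intro allI impI, elim conjE)
  fix S I J and f g :: "('i \<Rightarrow> real) \<Rightarrow> real"
  assume S: "finite S" "S \<subseteq> T" and IJ: "I \<subseteq> S" "J \<subseteq> S" "I \<inter> J = {}"
    and fg: "coordwise_nondecreasing I f" "coordwise_nondecreasing J g"
    and c: "covariance_exists M (\<lambda>\<omega>. f (\<lambda>k\<in>I. - X k \<omega>)) (\<lambda>\<omega>. g (\<lambda>k\<in>J. - X k \<omega>))"
  define f' where "f' x = - f (\<lambda>k\<in>I. - x k)" for x
  define g' where "g' x = - g (\<lambda>k\<in>J. - x k)" for x
  have 1: "f' (\<lambda>k\<in>I. x k) = - f (\<lambda>k\<in>I. - x k)" "g' (\<lambda>k\<in>J. x k) = - g (\<lambda>k\<in>J. - x k)" for x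
    unfolding f'_def g'_def by (auto intro!: arg_cong[of _ _ f] arg_cong[of _ _ g])
  have "coordwise_nondecreasing I f'" "coordwise_nondecreasing J g'"
    using fg unfolding coordwise_nondecreasing_def f'_def g'_def
    by (auto simp: PiE_def Pi_def extensional_def)
  moreover have "neg_associated_fin M X S" using NA S by (auto simp: neg_associated_def)
  moreover have "covariance_exists M (\<lambda>\<omega>. f' (\<lambda>k\<in>I. X k \<omega>)) (\<lambda>\<omega>. g' (\<lambda>k\<in>J. X k \<omega>))"
    using c by (simp add: covariance_exists_def 1)
  ultimately have "covariance M (\<lambda>\<omega>. f' (\<lambda>k\<in>I. X k \<omega>)) (\<lambda>\<omega>. g' (\<lambda>k\<in>J. X k \<omega>)) \<le> 0"
    using IJ unfolding neg_associated_fin_def by blast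
  also have "covariance M (\<lambda>\<omega>. f' (\<lambda>k\<in>I. X k \<omega>)) (\<lambda>\<omega>. g' (\<lambda>k\<in>J. X k \<omega>))
      = covariance M (\<lambda>\<omega>. f (\<lambda>k\<in>I. - X k \<omega>)) (\<lambda>\<omega>. g (\<lambda>k\<in>J. - X k \<omega>))"
    unfolding covariance_def 1
    by (rule Bochner_Integration.integral_cong) (auto simp: algebra_simps)
  finally show "covariance M (\<lambda>\<omega>. f (\<lambda>k\<in>I. - X k \<omega>)) (\<lambda>\<omega>. g (\<lambda>k\<in>J. - X k \<omega>)) \<le> 0" .
qed

section \<open>Maximal inequalities for partial sums\<close>

text \<open>\<open>max_run m k z\<close> is the maximum of \<open>0\<close> and the sums \<open>z k + \<dots> + z j\<close> with \<open>k \<le> j < k + m\<close>.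
  Peeling off the first summand writes it as a positive part of \<open>z k\<close> plus a nondecreasing
  function of the remaining variables, so that negative association kills the cross term.\<close>
fun max_run :: "nat \<Rightarrow> nat \<Rightarrow> (nat \<Rightarrow> real) \<Rightarrow> real" where
  "max_run 0 k z = 0"
| "max_run (Suc m) k z = max 0 (z k + max_run m (Suc k) z)"

lemma max_run_mono:
  "(\<And>i. i \<in> {k..<k+m} \<Longrightarrow> x i \<le> y i) \<Longrightarrow> max_run m k x \<le> max_run m k y"
proof (induction m arbitrary: k)
  case (Suc m)
  have "x k \<le> y k" "max_run m (Suc k) x \<le> max_run m (Suc k) y" using Suc by auto
  then show ?case by auto
qed simp

lemma sum_le_max_run: "j \<le> m \<Longrightarrow> (\<Sum>i=k..<k+j. z i) \<le> max_run m k z"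
proof (induction m arbitrary: j k)
  case (Suc m)
  show ?case
  proof (cases j)
    case (Suc i)
    then have "(\<Sum>i=k..<k+j. z i) = z k + (\<Sum>i=Suc k..<Suc k + i. z i)"
      by (subst sum.atLeast_Suc_lessThan) auto
    also have "\<dots> \<le> z k + max_run m (Suc k) z" using Suc.IH[of i "Suc k"] Suc.prems Suc by simp
    finally show ?thesis by simp
  qed simp
qed simp

lemma measurable_max_run [measurable]:
  assumes "\<And>i. i \<in> {k..<k+m} \<Longrightarrow> Z i \<in> borel_measurable M"
  shows "(\<lambda>\<omega>. max_run m k (\<lambda>i. Z i \<omega>)) \<in> borel_measurable M"
  using assms
proof (induction m arbitrary: k)
  case (Suc m)
  have [measurable]: "Z k \<in> borel_measurable M" "(\<lambda>\<omega>. max_run m (Suc k) (\<lambda>i. Z i \<omega>)) \<in> borel_measurable M"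
    using Suc by auto
  show ?case by simp
qed simp

lemma integrable_mult_square:
  fixes U V :: "'a \<Rightarrow> real"
  assumes [measurable]: "U \<in> borel_measurable M" "V \<in> borel_measurable M"
    and "integrable M (\<lambda>\<omega>. (U \<omega>)\<^sup>2)" "integrable M (\<lambda>\<omega>. (V \<omega>)\<^sup>2)"
  shows "integrable M (\<lambda>\<omega>. U \<omega> * V \<omega>)"
proof (rule Bochner_Integration.integrable_bound)
  show "integrable M (\<lambda>\<omega>. (U \<omega>)\<^sup>2 + (V \<omega>)\<^sup>2)" using assms by simp
  have "\<bar>u * v\<bar> \<le> u\<^sup>2 + v\<^sup>2" for u v :: real
    using sum_squares_bound[of "\<bar>u\<bar>" "\<bar>v\<bar>"] mult_nonneg_nonneg[of "\<bar>u\<bar>" "\<bar>v\<bar>"]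
    unfolding abs_mult power2_abs by linarith
  then show "AE \<omega> in M. norm (U \<omega> * V \<omega>) \<le> norm ((U \<omega>)\<^sup>2 + (V \<omega>)\<^sup>2)" by simp
qed simp

text \<open>Replacing \<open>max 0 (Z k + Q)\<close> by \<open>Z k + Q\<close> only increases the
  square, so second moments add up as for orthogonal variables, without the logarithmic factor that
  mere orthogonality would cost. Integrability is part of the induction because the cross term must
  be integrable before negative association applies to it.\<close>

lemma (in prob_space) neg_associated_max_run:
  assumes NA: "neg_associated M Z {1..}"
    and meas: "\<And>i. i \<ge> 1 \<Longrightarrow> Z i \<in> borel_measurable M"
    and sq: "\<And>i. i \<ge> 1 \<Longrightarrow> integrable M (\<lambda>\<omega>. (Z i \<omega>)\<^sup>2)"
    and mean: "\<And>i. i \<ge> 1 \<Longrightarrow> expectation (Z i) = 0"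
    and "k \<ge> 1"
  shows "integrable M (\<lambda>\<omega>. (max_run m k (\<lambda>i. Z i \<omega>))\<^sup>2) \<and>
    expectation (\<lambda>\<omega>. (max_run m k (\<lambda>i. Z i \<omega>))\<^sup>2) \<le> (\<Sum>i=k..<k+m. expectation (\<lambda>\<omega>. (Z i \<omega>)\<^sup>2))"
  using \<open>k \<ge> 1\<close>
proof (induction m arbitrary: k)
  case (Suc m)
  define Q where "Q \<omega> = max_run m (Suc k) (\<lambda>i. Z i \<omega>)" for \<omega>
  have [measurable]: "Q \<in> borel_measurable M" "Z k \<in> borel_measurable M"
    unfolding Q_def using meas Suc.prems by (auto intro!: measurable_max_run)
  have Q2: "integrable M (\<lambda>\<omega>. (Q \<omega>)\<^sup>2)"
    and QE: "expectation (\<lambda>\<omega>. (Q \<omega>)\<^sup>2) \<le> (\<Sum>i=Suc k..<Suc k+m. expectation (\<lambda>\<omega>. (Z i \<omega>)\<^sup>2))"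
    using Suc.IH[of "Suc k"] unfolding Q_def by auto
  have ZQ: "integrable M (\<lambda>\<omega>. Z k \<omega> * Q \<omega>)"
    by (rule integrable_mult_square) (use Q2 sq Suc.prems in auto)
  have Q1: "integrable M Q" by (rule square_integrable_imp_integrable[OF _ Q2]) measurable
  have "expectation (\<lambda>\<omega>. Z k \<omega> * Q \<omega>) \<le> expectation (Z k) * expectation Q"
    unfolding Q_def
  proof (rule neg_associated_expectation_le[OF NA, of "{k}" "{Suc k..<Suc k+m}" "\<lambda>z. z k" "max_run m (Suc k)"])
    show "integrable M (Z k)" using sq Suc.prems by (auto intro: square_integrable_imp_integrable[OF _ sq])
    show "integrable M (\<lambda>\<omega>. max_run m (Suc k) (\<lambda>i. Z i \<omega>))"
      using Q1 unfolding Q_def .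
    show "integrable M (\<lambda>\<omega>. Z k \<omega> * max_run m (Suc k) (\<lambda>i. Z i \<omega>))"
      using ZQ unfolding Q_def .
    show "max_run m (Suc k) x \<le> max_run m (Suc k) y" if "\<And>i. i \<in> {Suc k..<Suc k+m} \<Longrightarrow> x i \<le> y i" for x y
      by (rule max_run_mono) (rule that)
  qed (use Suc.prems in auto)
  then have cross: "expectation (\<lambda>\<omega>. Z k \<omega> * Q \<omega>) \<le> 0" using mean Suc.prems by simp
  have int: "integrable M (\<lambda>\<omega>. (Z k \<omega>)\<^sup>2 + 2 * (Z k \<omega> * Q \<omega>) + (Q \<omega>)\<^sup>2)"
    using Q2 ZQ sq Suc.prems by auto
  have le: "(max 0 (Z k \<omega> + Q \<omega>))\<^sup>2 \<le> (Z k \<omega>)\<^sup>2 + 2 * (Z k \<omega> * Q \<omega>) + (Q \<omega>)\<^sup>2" for \<omega>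
  proof -
    have "(max 0 (Z k \<omega> + Q \<omega>))\<^sup>2 \<le> (Z k \<omega> + Q \<omega>)\<^sup>2" by (auto simp: max_def)
    then show ?thesis by (simp add: power2_sum)
  qed
  have int': "integrable M (\<lambda>\<omega>. (max 0 (Z k \<omega> + Q \<omega>))\<^sup>2)"
    by (rule Bochner_Integration.integrable_bound[OF int]) (use le in \<open>auto intro: order_trans[OF _ abs_ge_self]\<close>)
  have "expectation (\<lambda>\<omega>. (max 0 (Z k \<omega> + Q \<omega>))\<^sup>2) \<le> expectation (\<lambda>\<omega>. (Z k \<omega>)\<^sup>2 + 2 * (Z k \<omega> * Q \<omega>) + (Q \<omega>)\<^sup>2)"
    by (rule integral_mono[OF int' int le])
  also have "\<dots> = expectation (\<lambda>\<omega>. (Z k \<omega>)\<^sup>2) + 2 * expectation (\<lambda>\<omega>. Z k \<omega> * Q \<omega>) + expectation (\<lambda>\<omega>. (Q \<omega>)\<^sup>2)"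
    using Q2 ZQ sq Suc.prems by simp
  also have "\<dots> \<le> expectation (\<lambda>\<omega>. (Z k \<omega>)\<^sup>2) + (\<Sum>i=Suc k..<Suc k+m. expectation (\<lambda>\<omega>. (Z i \<omega>)\<^sup>2))"
    using cross QE by simp
  also have "\<dots> = (\<Sum>i=k..<k+Suc m. expectation (\<lambda>\<omega>. (Z i \<omega>)\<^sup>2))"
    by (subst (2) sum.atLeast_Suc_lessThan) auto
  finally show ?case using int' by (simp add: Q_def)
qed simp

lemma max_partial_sum_ge: "k \<in> {1..n} \<Longrightarrow> \<bar>\<Sum>i=1..k. y i\<bar> \<le> max_partial_sum n y"
  unfolding max_partial_sum_def by (rule Max_ge) auto

lemma max_partial_sum_le:
  "n \<ge> 1 \<Longrightarrow> (\<And>k. k \<in> {1..n} \<Longrightarrow> \<bar>\<Sum>i=1..k. y i\<bar> \<le> c) \<Longrightarrow> max_partial_sum n y \<le> c"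
  unfolding max_partial_sum_def by (rule Max.boundedI) auto

lemma max_partial_sum_mono: "1 \<le> m \<Longrightarrow> m \<le> n \<Longrightarrow> max_partial_sum m y \<le> max_partial_sum n y"
  by (rule max_partial_sum_le) (auto intro!: max_partial_sum_ge simp flip: One_nat_def)

lemma max_partial_sum_add:
  assumes "n \<ge> 1"
  shows "max_partial_sum n (\<lambda>i. x i + y i) \<le> max_partial_sum n x + max_partial_sum n y"
proof (rule max_partial_sum_le[OF assms])
  fix k assume k: "k \<in> {1..n}"
  show "\<bar>\<Sum>i=1..k. x i + y i\<bar> \<le> max_partial_sum n x + max_partial_sum n y"
    using max_partial_sum_ge[OF k, of x] max_partial_sum_ge[OF k, of y] by (simp add: sum.distrib)
qed

lemma max_partial_sum_uminus: "max_partial_sum n (\<lambda>i. - y i) = max_partial_sum n y"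
  by (simp add: max_partial_sum_def sum_negf)

lemma max_partial_sum_nonneg: "n \<ge> 1 \<Longrightarrow> max_partial_sum n y \<ge> 0"
  using max_partial_sum_ge[of 1 n y] by auto

lemma max_partial_sum_cong: "(\<And>i. i \<in> {1..n} \<Longrightarrow> x i = y i) \<Longrightarrow> max_partial_sum n x = max_partial_sum n y"
  unfolding max_partial_sum_def by (intro arg_cong[of _ _ Max] image_cong arg_cong[of _ _ abs] sum.cong) auto

lemma measurable_max_partial_sum:
  assumes "n \<ge> 1" and [measurable]: "\<And>i. i \<in> {1..n} \<Longrightarrow> Z i \<in> borel_measurable M"
  shows "(\<lambda>\<omega>. max_partial_sum n (\<lambda>i. Z i \<omega>)) \<in> borel_measurable M"
  unfolding max_partial_sum_def by (intro borel_measurable_Max) (auto intro!: borel_measurable_sum borel_measurable_abs)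

text \<open>\<open>max_run\<close> sees only upward excursions, so the absolute value needs the run
  of the reflected sequence as well.\<close>

lemma max_partial_sum_le_max_run:
  assumes "n \<ge> 1"
  shows "max_partial_sum n y \<le> max (max_run n 1 y) (max_run n 1 (\<lambda>i. - y i))"
proof (rule max_partial_sum_le[OF assms])
  fix k assume k: "k \<in> {1..n}"
  have "{1..<1 + k} = {1..k}" by auto
  then show "\<bar>\<Sum>i=1..k. y i\<bar> \<le> max (max_run n 1 y) (max_run n 1 (\<lambda>i. - y i))"
    using sum_le_max_run[of k n y 1] sum_le_max_run[of k n "\<lambda>i. - y i" 1] k by (auto simp: sum_negf)
qed

text \<open>Reflection preserves negative association, so the upward and the downward run obey the
  same second moment bound. Markov's inequality for the sum of their squares gives the factor
  2.\<close>

lemma (in prob_space) neg_associated_maximal_inequality: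
  assumes NA: "neg_associated M Z {1..}"
    and meas: "\<And>i. i \<ge> 1 \<Longrightarrow> Z i \<in> borel_measurable M"
    and sq: "\<And>i. i \<ge> 1 \<Longrightarrow> integrable M (\<lambda>\<omega>. (Z i \<omega>)\<^sup>2)"
    and mean: "\<And>i. i \<ge> 1 \<Longrightarrow> expectation (Z i) = 0"
    and "n \<ge> 1" "t > 0"
  shows "prob {\<omega> \<in> space M. max_partial_sum n (\<lambda>i. Z i \<omega>) > t} \<le> 2 * (\<Sum>i=1..n. expectation (\<lambda>\<omega>. (Z i \<omega>)\<^sup>2)) / t\<^sup>2"
proof -
  define U where "U \<omega> = max_run n 1 (\<lambda>i. Z i \<omega>)" for \<omega>
  define V where "V \<omega> = max_run n 1 (\<lambda>i. - Z i \<omega>)" for \<omega>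
  define s where "s = (\<Sum>i=1..n. expectation (\<lambda>\<omega>. (Z i \<omega>)\<^sup>2))"
  have n: "{1..<1+n} = {1..n}" by auto
  have U: "integrable M (\<lambda>\<omega>. (U \<omega>)\<^sup>2)" "expectation (\<lambda>\<omega>. (U \<omega>)\<^sup>2) \<le> s"
    using neg_associated_max_run[OF NA meas sq mean, where k = 1 and m = n] unfolding U_def s_def n by auto
  have V: "integrable M (\<lambda>\<omega>. (V \<omega>)\<^sup>2)" "expectation (\<lambda>\<omega>. (V \<omega>)\<^sup>2) \<le> s"
    using neg_associated_max_run[OF neg_associated_uminus[OF NA], where k = 1 and m = n] meas sq mean unfolding V_def s_def n by auto
  have [measurable]: "U \<in> borel_measurable M" "V \<in> borel_measurable M"
    unfolding U_def V_def using meas by (auto intro!: measurable_max_run)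
  have "prob {\<omega> \<in> space M. max_partial_sum n (\<lambda>i. Z i \<omega>) > t} \<le> prob {\<omega> \<in> space M. (U \<omega>)\<^sup>2 + (V \<omega>)\<^sup>2 \<ge> t\<^sup>2}"
  proof (rule finite_measure_mono)
    show "{\<omega> \<in> space M. max_partial_sum n (\<lambda>i. Z i \<omega>) > t} \<subseteq> {\<omega> \<in> space M. (U \<omega>)\<^sup>2 + (V \<omega>)\<^sup>2 \<ge> t\<^sup>2}"
    proof safe
      fix \<omega> assume "max_partial_sum n (\<lambda>i. Z i \<omega>) > t"
      then have "t < max (U \<omega>) (V \<omega>)"
        using max_partial_sum_le_max_run[OF \<open>n \<ge> 1\<close>, of "\<lambda>i. Z i \<omega>"] by (simp add: U_def V_def)
      then have "t\<^sup>2 \<le> (U \<omega>)\<^sup>2 \<or> t\<^sup>2 \<le> (V \<omega>)\<^sup>2"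
        using \<open>t > 0\<close> by (auto simp: less_max_iff_disj intro: power_mono)
      then show "t\<^sup>2 \<le> (U \<omega>)\<^sup>2 + (V \<omega>)\<^sup>2" by (auto intro: add_increasing add_increasing2)
    qed
  qed measurable
  also have "\<dots> \<le> expectation (\<lambda>\<omega>. (U \<omega>)\<^sup>2 + (V \<omega>)\<^sup>2) / t\<^sup>2"
    using U V \<open>t > 0\<close> by (intro integral_Markov_inequality_measure[where A = "{}"]) auto
  also have "\<dots> \<le> 2 * s / t\<^sup>2" using U V by (intro divide_right_mono) auto
  finally show ?thesis by (simp add: s_def)
qed

text \<open>Multiplication by a nonnegative weight is monotone, so the positive and negative parts
  of the weights are treated separately. Halving the threshold costs a factor 4, whence the 8;
  nothing else is lost, since the squares of the two parts add up to the square of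
  \<open>a i\<close>.\<close>

lemma (in prob_space) neg_associated_weighted_maximal_inequality:
  assumes NA: "neg_associated M Z {1..}"
    and meas: "\<And>i. i \<ge> 1 \<Longrightarrow> Z i \<in> borel_measurable M"
    and sq: "\<And>i. i \<ge> 1 \<Longrightarrow> integrable M (\<lambda>\<omega>. (Z i \<omega>)\<^sup>2)"
    and mean: "\<And>i. i \<ge> 1 \<Longrightarrow> expectation (Z i) = 0"
    and "n \<ge> 1" "t > 0"
  shows "prob {\<omega> \<in> space M. max_partial_sum n (\<lambda>i. a i * Z i \<omega>) > t}
    \<le> 8 * (\<Sum>i=1..n. (a i)\<^sup>2 * expectation (\<lambda>\<omega>. (Z i \<omega>)\<^sup>2)) / t\<^sup>2"
proof -
  define u where "u i = max 0 (a i)" for i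
  define v where "v i = max 0 (- a i)" for i
  have pos: "prob {\<omega> \<in> space M. max_partial_sum n (\<lambda>i. c i * Z i \<omega>) > t / 2}
      \<le> 2 * (\<Sum>i=1..n. (c i)\<^sup>2 * expectation (\<lambda>\<omega>. (Z i \<omega>)\<^sup>2)) / (t / 2)\<^sup>2" if c: "\<And>i. c i \<ge> 0" for c
  proof -
    have "neg_associated M (\<lambda>i \<omega>. c i * Z i \<omega>) {1..}"
      by (rule neg_associated_comp_mono[OF NA]) (auto simp: mono_def c mult_left_mono)
    from neg_associated_maximal_inequality[OF this _ _ _ \<open>n \<ge> 1\<close>, of "t / 2"] show ?thesis
      using meas sq mean \<open>t > 0\<close> by (simp add: power_mult_distrib)
  qed
  have [measurable]: "(\<lambda>\<omega>. max_partial_sum n (\<lambda>i. c i * Z i \<omega>)) \<in> borel_measurable M" for c :: "nat \<Rightarrow> real"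
    using meas \<open>n \<ge> 1\<close> by (intro measurable_max_partial_sum) auto
  have "prob {\<omega> \<in> space M. max_partial_sum n (\<lambda>i. a i * Z i \<omega>) > t}
    \<le> prob ({\<omega> \<in> space M. max_partial_sum n (\<lambda>i. u i * Z i \<omega>) > t / 2}
          \<union> {\<omega> \<in> space M. max_partial_sum n (\<lambda>i. v i * Z i \<omega>) > t / 2})"
  proof (rule finite_measure_mono)
    show "{\<omega> \<in> space M. max_partial_sum n (\<lambda>i. a i * Z i \<omega>) > t}
      \<subseteq> {\<omega> \<in> space M. max_partial_sum n (\<lambda>i. u i * Z i \<omega>) > t / 2}
          \<union> {\<omega> \<in> space M. max_partial_sum n (\<lambda>i. v i * Z i \<omega>) > t / 2}"
    proof safe
      fix \<omega> assume 1: "max_partial_sum n (\<lambda>i. a i * Z i \<omega>) > t"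
        and 2: "\<not> t / 2 < max_partial_sum n (\<lambda>i. v i * Z i \<omega>)"
      have "(\<lambda>i. a i * Z i \<omega>) = (\<lambda>i. u i * Z i \<omega> + - (v i * Z i \<omega>))"
        by (auto simp: u_def v_def max_def algebra_simps)
      then have "max_partial_sum n (\<lambda>i. a i * Z i \<omega>)
          \<le> max_partial_sum n (\<lambda>i. u i * Z i \<omega>) + max_partial_sum n (\<lambda>i. v i * Z i \<omega>)"
        using max_partial_sum_add[OF \<open>n \<ge> 1\<close>, of "\<lambda>i. u i * Z i \<omega>" "\<lambda>i. - (v i * Z i \<omega>)"]
        by (simp add: max_partial_sum_uminus)
      then show "t / 2 < max_partial_sum n (\<lambda>i. u i * Z i \<omega>)" using 1 2 by simp
    qed
  qed measurable
  also have "\<dots> \<le> 2 * (\<Sum>i=1..n. (u i)\<^sup>2 * expectation (\<lambda>\<omega>. (Z i \<omega>)\<^sup>2)) / (t / 2)\<^sup>2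
      + 2 * (\<Sum>i=1..n. (v i)\<^sup>2 * expectation (\<lambda>\<omega>. (Z i \<omega>)\<^sup>2)) / (t / 2)\<^sup>2"
    by (rule order_trans[OF measure_Un_le]) (auto intro!: add_mono pos[simplified] simp: u_def[abs_def] v_def[abs_def])
  also have "\<dots> = 8 * (\<Sum>i=1..n. ((u i)\<^sup>2 + (v i)\<^sup>2) * expectation (\<lambda>\<omega>. (Z i \<omega>)\<^sup>2)) / t\<^sup>2"
    by (simp add: sum.distrib ring_distribs power_divide add_divide_distrib)
  also have "(\<lambda>i. (u i)\<^sup>2 + (v i)\<^sup>2) = (\<lambda>i. (a i)\<^sup>2)" by (auto simp: u_def v_def max_def)
  finally show ?thesis by (simp add: fun_eq_iff)
qed

section \<open>Product inequality for lower events and a converse of Borel-Cantelli\<close>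

lemma (in prob_space) neg_associated_prob_le_prod:
  assumes NA: "neg_associated M X T" and "finite S" "S \<subseteq> T"
    and meas: "\<And>i. i \<in> T \<Longrightarrow> X i \<in> borel_measurable M"
  shows "prob {\<omega> \<in> space M. \<forall>i\<in>S. X i \<omega> \<le> c i} \<le> (\<Prod>i\<in>S. prob {\<omega> \<in> space M. X i \<omega> \<le> c i})"
  using assms(2,3)
proof (induction S rule: finite_induct)
  case empty
  then show ?case by (simp add: prob_space)
next
  case (insert i S)
  \<comment> \<open>The event \<open>X i \<le> c i\<close> shrinks as the variable grows, so minus
    its indicator is the nondecreasing test function; in the product of the two functions the signs
    cancel.\<close>
  define F :: "('b \<Rightarrow> real) \<Rightarrow> real" where "F z = - of_bool (z i \<le> c i)" for z
  define G :: "('b \<Rightarrow> real) \<Rightarrow> real" where "G z = - of_bool (\<forall>j\<in>S. z j \<le> c j)" for z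
  define P where "P = {\<omega> \<in> space M. X i \<omega> \<le> c i}"
  define Q where "Q = {\<omega> \<in> space M. \<forall>j\<in>S. X j \<omega> \<le> c j}"
  have [measurable]: "X j \<in> borel_measurable M" if "j \<in> insert i S" for j
    using meas insert.prems that by auto
  have [measurable]: "P \<in> sets M" unfolding P_def by measurable
  have [measurable]: "Q \<in> sets M" unfolding Q_def
    using insert.hyps(1) by (intro sets.sets_Collect_finite_All) auto
  have FP: "F (\<lambda>i. X i \<omega>) = - indicator P \<omega>" if "\<omega> \<in> space M" for \<omega>
    using that by (auto simp: F_def P_def)
  have GQ: "G (\<lambda>i. X i \<omega>) = - indicator Q \<omega>" if "\<omega> \<in> space M" for \<omega>
    using that by (auto simp: G_def Q_def)
  have FG: "F (\<lambda>i. X i \<omega>) * G (\<lambda>i. X i \<omega>) = indicator (P \<inter> Q) \<omega>" if "\<omega> \<in> space M" for \<omega>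
    using FP[OF that] GQ[OF that] by (simp add: indicator_inter_arith)
  have E: "expectation (\<lambda>\<omega>. F (\<lambda>i. X i \<omega>)) = - prob P"
    "expectation (\<lambda>\<omega>. G (\<lambda>i. X i \<omega>)) = - prob Q"
    "expectation (\<lambda>\<omega>. F (\<lambda>i. X i \<omega>) * G (\<lambda>i. X i \<omega>)) = prob (P \<inter> Q)"
    by (simp_all only: FP GQ FG cong: Bochner_Integration.integral_cong) (simp_all flip: indicator_inter_arith)
  have "prob (P \<inter> Q) \<le> (- prob P) * (- prob Q)"
    unfolding E[symmetric]
  proof (rule neg_associated_expectation_le[OF NA, of "{i}" S])
    show "integrable M (\<lambda>\<omega>. F (\<lambda>i. X i \<omega>))" "integrable M (\<lambda>\<omega>. G (\<lambda>i. X i \<omega>))"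
      "integrable M (\<lambda>\<omega>. F (\<lambda>i. X i \<omega>) * G (\<lambda>i. X i \<omega>))"
      by (simp_all only: FP GQ FG cong: Bochner_Integration.integrable_cong)
        (auto simp: integrable_indicator_iff less_top[symmetric] simp flip: indicator_inter_arith)
  next
    fix x y assume "\<And>j. j \<in> S \<Longrightarrow> x j \<le> (y j :: real)"
    then have "\<forall>j\<in>S. y j \<le> c j \<Longrightarrow> \<forall>j\<in>S. x j \<le> c j" by (meson order_trans)
    then show "G x \<le> G y" by (auto simp: G_def)
  next
    fix x y assume "\<And>j. j \<in> {i} \<Longrightarrow> x j \<le> (y j :: real)"
    then have "x i \<le> y i" by simp
    then show "F x \<le> F y" by (auto simp: F_def)
  qed (use insert in auto)
  also have "\<dots> \<le> prob P * (\<Prod>i\<in>S. prob {\<omega> \<in> space M. X i \<omega> \<le> c i})"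
    using insert by (auto simp: Q_def intro!: mult_left_mono)
  also have "P \<inter> Q = {\<omega> \<in> space M. \<forall>i\<in>insert i S. X i \<omega> \<le> c i}" by (auto simp: P_def Q_def)
  finally show ?case using insert.hyps by (simp add: P_def)
qed

text \<open>Takes the place of the second Borel-Cantelli lemma, which rests on independence. Some
  tail event \<open>B m\<close> has probability above 1/2, and the product inequality bounds it by a
  product of factors \<open>1 - p n \<le> exp (- p n)\<close>; hence every partial sum starting at
  \<open>m\<close> is at most \<open>ln 2\<close>.\<close>

lemma (in prob_space) neg_associated_Borel_Cantelli:
  fixes X :: "nat \<Rightarrow> 'a \<Rightarrow> real"
  assumes NA: "neg_associated M X {1..}"
    and meas: "\<And>i. i \<ge> 1 \<Longrightarrow> X i \<in> borel_measurable M"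
    and ev: "AE \<omega> in M. \<forall>\<^sub>F n in sequentially. X n \<omega> \<le> c n"
  shows "summable (\<lambda>n. prob {\<omega> \<in> space M. X (Suc n) \<omega> > c (Suc n)})"
proof -
  \<comment> \<open>The shift by \<open>Suc\<close> keeps out \<open>X 0\<close>, which is not part
    of the negatively associated family.\<close>
  define B where "B m = {\<omega> \<in> space M. \<forall>n\<ge>m. X (Suc n) \<omega> \<le> c (Suc n)}" for m
  define p where "p n = prob {\<omega> \<in> space M. X (Suc n) \<omega> > c (Suc n)}" for n
  have [measurable]: "X (Suc n) \<in> borel_measurable M" for n using meas by simp
  have [measurable]: "B m \<in> sets M" for m unfolding B_def by measurable
  have "(\<lambda>m. prob (B m)) \<longlonglongrightarrow> prob (\<Union>m. B m)"
    by (rule finite_Lim_measure_incseq) (auto simp: incseq_def B_def)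
  also have "prob (\<Union>m. B m) = 1"
  proof (rule prob_eq_1[THEN iffD2])
    show "AE \<omega> in M. \<omega> \<in> (\<Union>m. B m)"
      using ev
    proof (rule AE_mp, intro AE_I2 impI)
      fix \<omega> assume "\<omega> \<in> space M" "\<forall>\<^sub>F n in sequentially. X n \<omega> \<le> c n"
      then show "\<omega> \<in> (\<Union>m. B m)" unfolding eventually_sequentially B_def
        using le_SucI by blast
    qed
  qed auto
  finally have "\<forall>\<^sub>F m in sequentially. prob (B m) > 1/2" by (rule order_tendstoD) simp
  then obtain m where m: "prob (B m) > 1/2" unfolding eventually_sequentially by blast
  have part: "(\<Sum>n=m..<k. p n) \<le> ln 2" for k
  proof -
    define S where "S = Suc ` {m..<k}"
    have "1/2 \<le> prob (B m)" using m by simp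
    also have "\<dots> \<le> prob {\<omega> \<in> space M. \<forall>i\<in>S. X i \<omega> \<le> c i}"
    proof (rule finite_measure_mono)
      have "\<forall>i\<in>S. X i \<in> borel_measurable M" using meas by (auto simp: S_def)
      then show "{\<omega> \<in> space M. \<forall>i\<in>S. X i \<omega> \<le> c i} \<in> sets M"
        by (intro sets.sets_Collect_finite_All borel_measurable_le) (auto simp: S_def)
      show "B m \<subseteq> {\<omega> \<in> space M. \<forall>i\<in>S. X i \<omega> \<le> c i}"
        unfolding B_def S_def by force
    qed
    also have "\<dots> \<le> (\<Prod>i\<in>S. prob {\<omega> \<in> space M. X i \<omega> \<le> c i})"
      by (rule neg_associated_prob_le_prod[OF NA]) (use meas in \<open>auto simp: S_def\<close>)
    also have "\<dots> = (\<Prod>n=m..<k. 1 - p n)"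
      unfolding S_def
    proof (subst prod.reindex, simp, rule prod.cong, simp, unfold o_def)
      fix n
      have "prob {\<omega> \<in> space M. \<not> X (Suc n) \<omega> > c (Suc n)} = 1 - p n"
        unfolding p_def by (rule prob_neg) measurable
      then show "prob {\<omega> \<in> space M. X (Suc n) \<omega> \<le> c (Suc n)} = 1 - p n" by (simp add: not_less)
    qed
    also have "\<dots> \<le> (\<Prod>n=m..<k. exp (- p n))"
      using exp_ge_add_one_self[of "- p n" for n] by (intro prod_mono) (auto simp: p_def)
    also have "\<dots> = exp (- (\<Sum>n=m..<k. p n))" by (simp add: exp_sum sum_negf[symmetric])
    finally have "ln (1/2) \<le> ln (exp (- (\<Sum>n=m..<k. p n)))" by (subst ln_le_cancel_iff) auto
    then show ?thesis by (simp add: ln_div)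
  qed
  have "summable (\<lambda>n. p (n + m))"
  proof (rule summableI_nonneg_bounded)
    show "(\<Sum>i<n. p (i + m)) \<le> ln 2" for n
      using part[of "n + m"] sum.shift_bounds_nat_ivl[of p 0 m n] by (simp add: lessThan_atLeast0)
  qed (simp add: p_def)
  then show ?thesis unfolding p_def by (rule summable_iff_shift[THEN iffD1])
qed

section \<open>Summability and dyadic Borel--Cantelli\<close>

text \<open>Lets the sums over admissible indices be handled as ordinary series, since only finitely
  many indices are missing.\<close>

lemma summable_on_cofinite_iff:
  fixes f :: "nat \<Rightarrow> real"
  assumes "\<And>n. f n \<ge> 0" and "finite (- I)"
  shows "f summable_on I \<longleftrightarrow> summable f"
proof
  assume "f summable_on I"
  moreover have "f summable_on (- I)" using assms(2) by simp
  ultimately have "f summable_on (I \<union> - I)" by (rule summable_on_Un_disjoint) auto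
  then show "summable f" by (auto intro: summable_on_imp_summable)
next
  assume "summable f"
  then have "f summable_on UNIV" using assms(1) by (rule summable_nonneg_imp_summable_on)
  then show "f summable_on I" by (rule summable_on_subset_banach) simp
qed

text \<open>Integral comparison done with the mean value theorem: each term is dominated by an
  increment of \<open>x powr (1 - p)\<close>, and the increments telescope.\<close>

lemma powr_tail_sum_le:
  fixes p :: real
  assumes p: "p > 1" and "m \<ge> 1"
  shows "(\<Sum>n\<in>{m<..m+k}. real n powr (- p)) \<le> real m powr (1 - p) / (p - 1)"
proof -
  have step: "(p - 1) * real (Suc n) powr (- p) \<le> real n powr (1 - p) - real (Suc n) powr (1 - p)" if "n \<ge> 1" for n
  proof -
    have "\<exists>z>real n. z < real (Suc n) \<and> real (Suc n) powr (1 - p) - real n powr (1 - p)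
        = (real (Suc n) - real n) * ((1 - p) * z powr (1 - p - 1))"
      by (rule MVT2) (use that in \<open>auto intro!: derivative_eq_intros\<close>)
    then obtain z where z: "z > real n" "z < real (Suc n)"
      "real (Suc n) powr (1 - p) - real n powr (1 - p) = (1 - p) * z powr (- p)" by auto
    have "real (Suc n) powr (- p) \<le> z powr (- p)"
      using z p by (intro powr_mono2') auto
    then have "(p - 1) * real (Suc n) powr (- p) \<le> (p - 1) * z powr (- p)"
      using p by (intro mult_left_mono) auto
    then show ?thesis using z(3) by (simp add: algebra_simps)
  qed
  have "(p - 1) * (\<Sum>n\<in>{m<..m+k}. real n powr (- p)) \<le> real m powr (1 - p) - real (m + k) powr (1 - p)"
  proof (induction k)
    case (Suc k)
    have "{m<..m + Suc k} = insert (Suc (m + k)) {m<..m + k}" by auto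
    then have "(p - 1) * (\<Sum>n\<in>{m<..m + Suc k}. real n powr (- p))
      = (p - 1) * real (Suc (m + k)) powr (- p) + (p - 1) * (\<Sum>n\<in>{m<..m + k}. real n powr (- p))"
      by (simp add: algebra_simps)
    then show ?case using Suc step[of "m + k"] \<open>m \<ge> 1\<close> by simp
  qed simp
  also have "\<dots> \<le> real m powr (1 - p)" by simp
  finally show ?thesis using p by (simp add: field_simps)
qed

text \<open>Used with \<open>h = 1 + G t\<close>, where linearity in \<open>h\<close> is what turns
  the moment condition into summability. Up to an index of order \<open>h\<close> the terms are
  bounded by 1; beyond it the tail of the power series is again of order \<open>h\<close>.\<close>

lemma sum_min_powr_le:
  fixes p C h :: real
  assumes p: "p > 1" and C: "C > 0" and h: "h \<ge> 1"
  shows "(\<Sum>n=1..k. min 1 (C * (h / real n) powr p)) \<le> (2 + C / (p - 1)) * h"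
proof -
  define m where "m = nat \<lceil>h\<rceil>"
  have m: "real m \<ge> h" "real m \<le> h + 1" "m \<ge> 1" using h unfolding m_def by linarith+
  have "(\<Sum>n=1..k. min 1 (C * (h / real n) powr p)) \<le> (\<Sum>n\<in>{1..m} \<union> {m<..m+k}. min 1 (C * (h / real n) powr p))"
    using C by (intro sum_mono2) auto
  also have "\<dots> = (\<Sum>n=1..m. min 1 (C * (h / real n) powr p)) + (\<Sum>n\<in>{m<..m+k}. min 1 (C * (h / real n) powr p))"
    by (rule sum.union_disjoint) auto
  also have "\<dots> \<le> (\<Sum>n=1..m. 1) + (\<Sum>n\<in>{m<..m+k}. C * h powr p * real n powr (- p))"
  proof (intro add_mono sum_mono)
    fix n assume "n \<in> {m<..m+k}"
    have "min 1 (C * (h / real n) powr p) \<le> C * (h / real n) powr p" by simp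
    also have "\<dots> = C * h powr p * real n powr (- p)" using h by (simp add: powr_divide powr_minus_divide)
    finally show "min 1 (C * (h / real n) powr p) \<le> C * h powr p * real n powr (- p)" .
  qed auto
  also have "\<dots> = real m + C * h powr p * (\<Sum>n\<in>{m<..m+k}. real n powr (- p))"
    by (simp add: sum_distrib_left)
  also have "\<dots> \<le> real m + C * h powr p * (real m powr (1 - p) / (p - 1))"
    using powr_tail_sum_le[OF p m(3), of k] C by (intro add_left_mono mult_left_mono) auto
  also have "\<dots> \<le> 2 * h + C * h powr p * (h powr (1 - p) / (p - 1))"
    using m h p C by (intro add_mono mult_left_mono divide_right_mono powr_mono2') auto
  also have "\<dots> = 2 * h + C / (p - 1) * (h powr p * h powr (1 - p))" by simp
  also have "h powr p * h powr (1 - p) = h" using h by (simp flip: powr_add)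
  finally show ?thesis by (simp add: algebra_simps)
qed

section \<open>From summable probabilities to almost sure convergence\<close>

context prob_space begin

text \<open>The weights \<open>1 / n\<close> match dyadic blocks: a block has \<open>2^j\<close>
  terms of weight at least \<open>1 / (2 * 2^j)\<close>, so its sum is at least half of the
  probability \<open>q j\<close> at its left end. One factor \<open>C\<close> is paid for moving the
  threshold to \<open>2^j\<close>, the second for filling in the indices between powers of
  two.\<close>

lemma AE_max_partial_sum_le:
  assumes meas: "\<And>i. i \<ge> 1 \<Longrightarrow> Z i \<in> borel_measurable M"
    and sm: "summable (\<lambda>n. 1 / real n * prob {\<omega> \<in> space M. max_partial_sum n (\<lambda>i. Z i \<omega>) > \<epsilon> * b n})"
    and C: "C > 0" "\<forall>\<^sub>F n in sequentially. \<forall>m. n \<le> m \<and> m \<le> 2 * n \<longrightarrow> b m \<le> C * b n \<and> b n \<le> C * b m"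
    and "\<epsilon> > 0"
  shows "AE \<omega> in M. \<forall>\<^sub>F n in sequentially. max_partial_sum n (\<lambda>i. Z i \<omega>) \<le> \<epsilon> * C\<^sup>2 * b n"
proof -
  define S where "S n \<omega> = max_partial_sum n (\<lambda>i. Z i \<omega>)" for n \<omega>
  define f where "f n = 1 / real n * prob {\<omega> \<in> space M. S n \<omega> > \<epsilon> * b n}" for n
  define q where "q j = prob {\<omega> \<in> space M. S (2^j) \<omega> > \<epsilon> * C * b (2^j)}" for j :: nat
  define B where "B j = (\<Sum>n=2^j..<2^Suc j. f n)" for j :: nat
  have [measurable]: "S n \<in> borel_measurable M" if "n \<ge> 1" for n
    unfolding S_def using meas that by (intro measurable_max_partial_sum) auto
  have smf: "summable f" using sm unfolding f_def S_def .
  have f0: "f n \<ge> 0" for n by (simp add: f_def)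
  have B0: "B j \<ge> 0" for j by (simp add: B_def sum_nonneg f0)
  have "(\<Sum>j<J. B j) = (\<Sum>n=1..<2^J. f n)" for J
  proof (induction J)
    case (Suc J)
    have "(\<Sum>j<Suc J. B j) = (\<Sum>n=1..<2^J. f n) + (\<Sum>n=2^J..<2^Suc J. f n)" using Suc by (simp add: B_def)
    also have "\<dots> = (\<Sum>n=1..<2^Suc J. f n)" by (rule sum.atLeastLessThan_concat) auto
    finally show ?case .
  qed simp
  moreover have "(\<Sum>n=1..<2^J. f n) \<le> suminf f" for J :: nat
    by (rule sum_le_suminf[OF smf]) (auto simp: f0)
  ultimately have "summable B" by (intro summableI_nonneg_bounded[of B "suminf f"]) (auto simp: B0)
  obtain n0 where n0: "\<And>n m. n \<ge> n0 \<Longrightarrow> n \<le> m \<Longrightarrow> m \<le> 2 * n \<Longrightarrow> b m \<le> C * b n \<and> b n \<le> C * b m"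
    using C(2) unfolding eventually_sequentially by blast
  have pw: "2 ^ j \<ge> j" for j :: nat using less_exp[of j] by simp
  have qB: "q j \<le> 2 * B j" if j: "j \<ge> n0" for j
  proof -
    have le: "q j / (2 * 2^j) \<le> f n" if n: "n \<in> {2^j..<2^Suc j}" for n
    proof -
      have n1: "n \<ge> 1" "(2::nat)^j \<ge> 1" using n by (auto intro: order_trans[of 1 "2^j" n])
      have bn: "b n \<le> C * b (2^j)" using n0[of "2^j" n] pw[of j] j n by auto
      have "q j \<le> prob {\<omega> \<in> space M. S n \<omega> > \<epsilon> * b n}"
        unfolding q_def
      proof (rule finite_measure_mono)
        show "{\<omega> \<in> space M. S (2^j) \<omega> > \<epsilon> * C * b (2^j)} \<subseteq> {\<omega> \<in> space M. S n \<omega> > \<epsilon> * b n}"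
        proof safe
          fix \<omega> assume "S (2^j) \<omega> > \<epsilon> * C * b (2^j)"
          moreover have "S (2^j) \<omega> \<le> S n \<omega>" unfolding S_def using n n1 by (intro max_partial_sum_mono) auto
          moreover have "\<epsilon> * b n \<le> \<epsilon> * (C * b (2^j))" using bn \<open>\<epsilon> > 0\<close> by (intro mult_left_mono) auto
          ultimately show "S n \<omega> > \<epsilon> * b n" by simp
        qed
      qed (use n1 in measurable)
      then have "1 / real n * q j \<le> f n" unfolding f_def by (intro mult_left_mono) auto
      moreover have "real n \<le> 2 * 2^j" using n by (metis atLeastLessThan_iff less_imp_le of_nat_le_iff of_nat_numeral of_nat_power power_Suc)
      then have "q j / (2 * 2^j) \<le> q j / real n" using n1 by (intro divide_left_mono) (auto simp: q_def)
      ultimately show ?thesis by simp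
    qed
    have "(\<Sum>n=(2::nat)^j..<2^Suc j. q j / (2 * 2^j)) \<le> B j" unfolding B_def by (rule sum_mono) (rule le)
    then show ?thesis by simp
  qed
  have "summable q"
  proof (rule summable_comparison_test_ev[OF _ summable_mult[OF \<open>summable B\<close>, of 2]])
    show "\<forall>\<^sub>F j in sequentially. norm (q j) \<le> 2 * B j"
      using eventually_ge_at_top[of n0] by eventually_elim (use qB in \<open>auto simp: q_def\<close>)
  qed
  then have "AE \<omega> in M. \<forall>\<^sub>F j in sequentially. \<omega> \<in> space M - {\<omega> \<in> space M. S (2^j) \<omega> > \<epsilon> * C * b (2^j)}"
    unfolding q_def by (intro borel_cantelli_AE1) (auto simp: less_top[symmetric])
  then show ?thesis
  proof (rule AE_mp, intro AE_I2 impI)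
    fix \<omega> assume "\<omega> \<in> space M" "\<forall>\<^sub>F j in sequentially. \<omega> \<in> space M - {\<omega> \<in> space M. S (2^j) \<omega> > \<epsilon> * C * b (2^j)}"
    then obtain j0 where j0: "\<And>j. j \<ge> j0 \<Longrightarrow> S (2^j) \<omega> \<le> \<epsilon> * C * b (2^j)"
      unfolding eventually_sequentially by (auto simp: not_less)
    have "S n \<omega> \<le> \<epsilon> * C\<^sup>2 * b n" if n: "n \<ge> 2 ^ j0 + n0" for n
    proof -
      have n1: "n \<ge> 1" using n by (metis add_leD1 one_le_numeral one_le_power order_trans)
      obtain j where j: "2^j \<le> n" "n < 2^Suc j" using ex_power_ivl1[OF order_refl n1] by auto
      have "(2::nat) ^ j0 < 2 ^ Suc j" using n j by linarith
      then have "j0 \<le> Suc j" by (metis less_imp_le power_less_imp_less_exp one_less_numeral_iff semiring_norm(76))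
      \<comment> \<open>The maximum is monotone in the index, so \<open>n\<close> may be rounded up
        to a power of two; this power is at most \<open>2 * n\<close>, which keeps \<open>b\<close>
        comparable.\<close>
      have "S n \<omega> \<le> S (2^Suc j) \<omega>" unfolding S_def using j n1 by (intro max_partial_sum_mono) auto
      also have "\<dots> \<le> \<epsilon> * C * b (2^Suc j)" by (rule j0) fact
      also have "\<dots> \<le> \<epsilon> * C * (C * b n)"
        using n0[of n "2^Suc j"] n j C \<open>\<epsilon> > 0\<close> by (intro mult_left_mono) auto
      finally show ?thesis by (simp add: power2_eq_square mult_ac)
    qed
    then show "\<forall>\<^sub>F n in sequentially. max_partial_sum n (\<lambda>i. Z i \<omega>) \<le> \<epsilon> * C\<^sup>2 * b n"
      unfolding eventually_sequentially S_def by blast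
  qed
qed

text \<open>Countably many values of \<epsilon> suffice, and the fixed dyadic factor is harmless
  because \<epsilon> is arbitrarily small.\<close>

lemma AE_max_partial_sum_tendsto:
  assumes meas: "\<And>i. i \<ge> 1 \<Longrightarrow> Z i \<in> borel_measurable M"
    and sm: "\<And>\<epsilon>. \<epsilon> > 0 \<Longrightarrow>
      summable (\<lambda>n. 1 / real n * prob {\<omega> \<in> space M. max_partial_sum n (\<lambda>i. Z i \<omega>) > \<epsilon> * b n})"
    and C: "C > 0" "\<forall>\<^sub>F n in sequentially. \<forall>m. n \<le> m \<and> m \<le> 2 * n \<longrightarrow> b m \<le> C * b n \<and> b n \<le> C * b m"
    and pos: "\<forall>\<^sub>F n in sequentially. b n > 0"
  shows "AE \<omega> in M. (\<lambda>n. max_partial_sum n (\<lambda>i. Z i \<omega>) / b n) \<longlonglongrightarrow> 0"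
proof -
  have "AE \<omega> in M. \<forall>\<^sub>F n in sequentially. max_partial_sum n (\<lambda>i. Z i \<omega>) \<le> 1 / real (Suc k) * C\<^sup>2 * b n" for k
    by (rule AE_max_partial_sum_le[OF meas sm C]) auto
  then have "AE \<omega> in M. \<forall>k. \<forall>\<^sub>F n in sequentially. max_partial_sum n (\<lambda>i. Z i \<omega>) \<le> 1 / real (Suc k) * C\<^sup>2 * b n"
    by (simp add: AE_all_countable)
  then show ?thesis
  proof (rule AE_mp, intro AE_I2 impI)
    fix \<omega> assume le: "\<forall>k. \<forall>\<^sub>F n in sequentially. max_partial_sum n (\<lambda>i. Z i \<omega>) \<le> 1 / real (Suc k) * C\<^sup>2 * b n"
    show "(\<lambda>n. max_partial_sum n (\<lambda>i. Z i \<omega>) / b n) \<longlonglongrightarrow> 0"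
    proof (rule tendstoI)
      fix e :: real assume "e > 0"
      obtain k where "C\<^sup>2 / e < real k" using reals_Archimedean2 by blast
      then have k: "1 / real (Suc k) * C\<^sup>2 < e" using \<open>e > 0\<close> by (simp add: field_simps)
      show "\<forall>\<^sub>F n in sequentially. dist (max_partial_sum n (\<lambda>i. Z i \<omega>) / b n) 0 < e"
        using le[rule_format, of k] pos eventually_ge_at_top[of 1]
      proof eventually_elim
        case (elim n)
        have "max_partial_sum n (\<lambda>i. Z i \<omega>) < e * b n"
          using elim(1) mult_strict_right_mono[OF k elim(2)] by linarith
        moreover have "max_partial_sum n (\<lambda>i. Z i \<omega>) \<ge> 0" using elim by (intro max_partial_sum_nonneg)
        ultimately show ?case using elim by (simp add: dist_real_def divide_less_eq)
      qed
    qed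
  qed
qed

end

section \<open>The equivalence\<close>

text \<open>\<open>Y\<close> lives on a probability space of its own and is tied to the sequence
  only through its distribution; the moments are computed there and transferred.\<close>

locale neg_associated_sequence = de_bruijn_norming A \<alpha> L Lt b + prob_space M + N: prob_space N
  for A \<alpha> :: real and L Lt :: "real \<Rightarrow> real" and b :: "nat \<Rightarrow> real"
    and M :: "'a measure" and N :: "'b measure" +
  fixes X :: "nat \<Rightarrow> 'a \<Rightarrow> real" and Y :: "'b \<Rightarrow> real"
  assumes X_rv: "\<And>n. n \<ge> 1 \<Longrightarrow> X n \<in> borel_measurable M"
    and Y_rv [measurable]: "Y \<in> borel_measurable N"
    and same_distr: "\<And>n. n \<ge> 1 \<Longrightarrow> distr M borel (X n) = distr N borel Y"
    and NA: "neg_associated M X {1..}"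
begin

lemma b_ev_pos: "\<forall>\<^sub>F n in sequentially. n \<ge> 1 \<and> b n > 0"
  using index_large
proof eventually_elim
  case (elim n)
  then show ?case using b_pos[of n] by blast
qed

lemma expectation_X:
  assumes "n \<ge> 1" and [measurable]: "g \<in> borel_measurable borel"
  shows "expectation (\<lambda>\<omega>. g (X n \<omega>) :: real) = N.expectation (\<lambda>\<omega>. g (Y \<omega>))"
  using integral_distr[OF X_rv[OF assms(1)] assms(2)] integral_distr[OF Y_rv assms(2)]
  by (simp add: same_distr[OF assms(1)])

lemma prob_X:
  assumes "n \<ge> 1" and [measurable]: "Measurable.pred borel P"
  shows "prob {\<omega> \<in> space M. P (X n \<omega>)} = N.prob {\<omega> \<in> space N. P (Y \<omega>)}"
proof -
  have [measurable]: "X n \<in> borel_measurable M" by (rule X_rv) fact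
  have "prob {\<omega> \<in> space M. P (X n \<omega>)} = measure (distr M borel (X n)) {x \<in> space borel. P x}"
    by (subst measure_distr) (auto intro!: arg_cong[of _ _ prob])
  also have "\<dots> = N.prob {\<omega> \<in> space N. P (Y \<omega>)}"
    unfolding same_distr[OF assms(1)]
    by (subst measure_distr) (auto intro!: arg_cong[of _ _ N.prob])
  finally show ?thesis .
qed

section \<open>Moments of the common distribution\<close>

lemma measurable_G_Y [measurable]: "(\<lambda>\<omega>. G \<bar>Y \<omega>\<bar>) \<in> borel_measurable N"
proof -
  have "(\<lambda>\<omega>. \<bar>Y \<omega>\<bar> + A) \<in> N \<rightarrow>\<^sub>M restrict_space borel {A..}"
    by (rule measurable_restrict_space2) auto
  moreover have "L \<in> restrict_space borel {A..} \<rightarrow>\<^sub>M borel" using L by (simp add: slowly_varying_def)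
  ultimately have [measurable]: "(\<lambda>\<omega>. L (\<bar>Y \<omega>\<bar> + A)) \<in> borel_measurable N"
    by (rule measurable_compose)
  show ?thesis unfolding G_def by measurable
qed

text \<open>One quantity for both effects of truncation: for positive \<open>b n\<close> it
  dominates the probability that \<open>|Y|\<close> exceeds \<open>b n\<close>, and its product with
  the square of \<open>b n\<close> is the second moment of the clipped variable.\<close>

definition V :: "nat \<Rightarrow> real" where "V n = N.expectation (\<lambda>\<omega>. min 1 ((\<bar>Y \<omega>\<bar> / b n)\<^sup>2))"

lemma V_integrable: "integrable N (\<lambda>\<omega>. min 1 ((\<bar>Y \<omega>\<bar> / b n)\<^sup>2))"
  by (rule N.integrable_const_bound[of _ 1]) auto

lemma V_nonneg: "V n \<ge> 0"
  unfolding V_def by (intro Bochner_Integration.integral_nonneg) auto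

text \<open>Expectation and summation are exchanged for finite sums only; pointwise these are at
  most a constant multiple of \<open>1 + G |Y|\<close>, uniformly in the number of terms.\<close>

lemma V_summable:
  assumes mom: "integrable N (\<lambda>\<omega>. G \<bar>Y \<omega>\<bar>)"
  shows "summable V"
proof -
  obtain p C where pC: "p > 1" "C > 0"
    "\<forall>\<^sub>F n in sequentially. \<forall>t\<ge>0. min 1 ((t / b n)\<^sup>2) \<le> C * ((1 + G t) / real n) powr p"
    by (rule truncated_square_le) blast
  obtain n0 where n0: "\<And>n t. n \<ge> n0 \<Longrightarrow> t \<ge> 0 \<Longrightarrow> min 1 ((t / b n)\<^sup>2) \<le> C * ((1 + G t) / real n) powr p"
    using pC(3) unfolding eventually_sequentially by blast
  define D where "D = 2 + C / (p - 1)"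
  have partial: "(\<Sum>n<k. V (n + Suc n0)) \<le> N.expectation (\<lambda>\<omega>. D * (1 + G \<bar>Y \<omega>\<bar>))" for k
  proof -
    have "(\<Sum>n<k. V (n + Suc n0)) = N.expectation (\<lambda>\<omega>. \<Sum>n<k. min 1 ((\<bar>Y \<omega>\<bar> / b (n + Suc n0))\<^sup>2))"
      unfolding V_def by (subst Bochner_Integration.integral_sum) (auto intro: V_integrable)
    also have "\<dots> \<le> N.expectation (\<lambda>\<omega>. D * (1 + G \<bar>Y \<omega>\<bar>))"
    proof (rule integral_mono)
      show "integrable N (\<lambda>\<omega>. \<Sum>n<k. min 1 ((\<bar>Y \<omega>\<bar> / b (n + Suc n0))\<^sup>2))"
        by (intro Bochner_Integration.integrable_sum V_integrable)
      show "integrable N (\<lambda>\<omega>. D * (1 + G \<bar>Y \<omega>\<bar>))" using mom by simp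
      fix \<omega>
      define t where "t = \<bar>Y \<omega>\<bar>"
      have "(\<Sum>n<k. min 1 ((t / b (n + Suc n0))\<^sup>2))
          \<le> (\<Sum>n<k. min 1 (C * ((1 + G t) / real (n + Suc n0)) powr p))"
        using n0[of "n + Suc n0" t for n] by (intro sum_mono) (auto simp: t_def)
      also have "\<dots> = (\<Sum>n=Suc n0..<k + Suc n0. min 1 (C * ((1 + G t) / real n) powr p))"
        by (subst sum.shift_bounds_nat_ivl[of _ 0 "Suc n0" k, simplified add_0]) (simp add: lessThan_atLeast0)
      also have "\<dots> \<le> (\<Sum>n=1..k + Suc n0. min 1 (C * ((1 + G t) / real n) powr p))"
        using pC by (intro sum_mono2) auto
      also have "\<dots> \<le> D * (1 + G t)"
        unfolding D_def by (rule sum_min_powr_le) (use pC G_nonneg in auto)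
      finally show "(\<Sum>n<k. min 1 ((\<bar>Y \<omega>\<bar> / b (n + Suc n0))\<^sup>2)) \<le> D * (1 + G \<bar>Y \<omega>\<bar>)" by (simp add: t_def)
    qed
    finally show ?thesis .
  qed
  have "summable (\<lambda>n. V (n + Suc n0))"
    by (rule summableI_nonneg_bounded[OF V_nonneg partial])
  then show ?thesis by (rule summable_iff_shift[THEN iffD1])
qed

definition tail :: "nat \<Rightarrow> real" where "tail n = N.expectation (\<lambda>\<omega>. \<bar>Y \<omega>\<bar> * indicator {x. \<bar>x\<bar> > b n} (Y \<omega>))"

text \<open>A single suitable index \<open>n\<close> is enough: above \<open>b n\<close> the
  variable is dominated by a multiple of \<open>G |Y|\<close>, and below it by the constant
  \<open>b n\<close>.\<close>

lemma Y_integrable: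
  assumes mom: "integrable N (\<lambda>\<omega>. G \<bar>Y \<omega>\<bar>)"
  shows "integrable N Y"
proof -
  obtain C where C: "C > 0" "\<forall>\<^sub>F n in sequentially. \<forall>t. t > b n \<longrightarrow> real n * t / b n \<le> C * G t"
    by (rule tail_le) blast
  obtain n where n: "n \<ge> 1" "b n > 0" "\<And>t. t > b n \<Longrightarrow> real n * t / b n \<le> C * G t"
    using eventually_happens'[OF _ eventually_conj[OF b_ev_pos C(2)]] by auto
  show ?thesis
  proof (rule Bochner_Integration.integrable_bound)
    show "integrable N (\<lambda>\<omega>. b n + b n * C * G \<bar>Y \<omega>\<bar>)" using mom by simp
    have "\<bar>y\<bar> \<le> b n + b n * C * G \<bar>y\<bar>" for y
    proof (cases "\<bar>y\<bar> > b n")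
      case True
      have "1 * \<bar>y\<bar> \<le> real n * \<bar>y\<bar>" using n by (intro mult_right_mono) auto
      also have "\<dots> \<le> b n * C * G \<bar>y\<bar>" using n(3)[OF True] n(2) by (simp add: field_simps)
      finally show ?thesis using n by simp
    next
      case False
      have "0 \<le> b n * C * G \<bar>y\<bar>" using n C G_nonneg by simp
      then show ?thesis using False by linarith
    qed
    then show "AE \<omega> in N. norm (Y \<omega>) \<le> norm (b n + b n * C * G \<bar>Y \<omega>\<bar>)"
      by (auto intro: order_trans[OF _ abs_ge_self])
  qed simp
qed

text \<open>The factor \<open>n / b n\<close> is absorbed into \<open>C * G |Y|\<close> restricted
  to the event \<open>|Y| > b n\<close>. At each outcome this restriction is eventually 0 because
  \<open>b n\<close> tends to infinity, so dominated convergence applies.\<close>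

lemma tail_tendsto:
  assumes mom: "integrable N (\<lambda>\<omega>. G \<bar>Y \<omega>\<bar>)"
  shows "(\<lambda>n. real n * tail n / b n) \<longlonglongrightarrow> 0"
proof -
  obtain C where C: "C > 0" "\<forall>\<^sub>F n in sequentially. \<forall>t. t > b n \<longrightarrow> real n * t / b n \<le> C * G t"
    by (rule tail_le) blast
  define s where "s n \<omega> = C * G \<bar>Y \<omega>\<bar> * indicator {x. \<bar>x\<bar> > b n} (Y \<omega>)" for n \<omega>
  have [measurable]: "s n \<in> borel_measurable N" for n unfolding s_def by measurable
  have s0: "0 \<le> s n \<omega>" "s n \<omega> \<le> C * G \<bar>Y \<omega>\<bar>" for n \<omega>
    using C G_nonneg by (auto simp: s_def indicator_def)
  have s_int: "integrable N (s n)" for n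
    by (rule Bochner_Integration.integrable_bound[of _ "\<lambda>\<omega>. C * G \<bar>Y \<omega>\<bar>"])
      (use mom s0 C G_nonneg in auto)
  have "(\<lambda>n. N.expectation (s n)) \<longlonglongrightarrow> N.expectation (\<lambda>_. 0)"
  proof (rule integral_dominated_convergence[where w = "\<lambda>\<omega>. C * G \<bar>Y \<omega>\<bar>"])
    show "AE \<omega> in N. (\<lambda>n. s n \<omega>) \<longlonglongrightarrow> 0"
    proof (intro AE_I2 tendsto_eventually)
      fix \<omega>
      show "\<forall>\<^sub>F n in sequentially. s n \<omega> = 0"
        using b_at_top[unfolded filterlim_at_top, rule_format, of "\<bar>Y \<omega>\<bar>"]
        by eventually_elim (auto simp: s_def)
    qed
  qed (use mom s0 in auto)
  then have lim: "(\<lambda>n. N.expectation (s n)) \<longlonglongrightarrow> 0" by simp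
  have int: "integrable N (\<lambda>\<omega>. \<bar>Y \<omega>\<bar> * indicator {x. \<bar>x\<bar> > b n} (Y \<omega>))" for n
    by (rule Bochner_Integration.integrable_bound[OF Y_integrable[OF mom]]) (auto simp: indicator_def)
  show ?thesis
  proof (rule real_tendsto_sandwich[OF _ _ tendsto_const lim])
    show "\<forall>\<^sub>F n in sequentially. 0 \<le> real n * tail n / b n"
      using b_ev_pos by eventually_elim (auto simp: tail_def intro!: divide_nonneg_pos mult_nonneg_nonneg Bochner_Integration.integral_nonneg)
    show "\<forall>\<^sub>F n in sequentially. real n * tail n / b n \<le> N.expectation (s n)"
      using b_ev_pos C(2)
    proof eventually_elim
      case (elim n)
      have "real n * tail n / b n = N.expectation (\<lambda>\<omega>. real n / b n * (\<bar>Y \<omega>\<bar> * indicator {x. \<bar>x\<bar> > b n} (Y \<omega>)))"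
        unfolding tail_def by simp
      also have "\<dots> \<le> N.expectation (s n)"
      proof (rule integral_mono)
        show "integrable N (\<lambda>\<omega>. real n / b n * (\<bar>Y \<omega>\<bar> * indicator {x. \<bar>x\<bar> > b n} (Y \<omega>)))"
          using int by simp
        show "real n / b n * (\<bar>Y \<omega>\<bar> * indicator {x. \<bar>x\<bar> > b n} (Y \<omega>)) \<le> s n \<omega>" for \<omega>
          using elim(2) by (auto simp: s_def indicator_def)
      qed (rule s_int)
      finally show ?case .
    qed
  qed
qed

section \<open>Clipping and the probability bound for weighted sums\<close>

definition trunc :: "nat \<Rightarrow> real \<Rightarrow> real" where "trunc n x = max (- b n) (min (b n) x)"

lemma measurable_trunc [measurable]: "trunc n \<in> borel_measurable borel"
  unfolding trunc_def by measurable

text \<open>Clipping changes a value only beyond the level \<open>b n\<close>, and then by at most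
  its absolute value.\<close>

lemma trunc_mean_le:
  assumes mom: "integrable N (\<lambda>\<omega>. G \<bar>Y \<omega>\<bar>)" and "b n > 0"
  shows "\<bar>N.expectation (\<lambda>\<omega>. trunc n (Y \<omega>)) - N.expectation Y\<bar> \<le> tail n"
proof -
  have 1: "integrable N (\<lambda>\<omega>. trunc n (Y \<omega>))"
    by (rule N.integrable_const_bound[of _ "b n"]) (use \<open>b n > 0\<close> in \<open>auto simp: trunc_def\<close>)
  have 2: "integrable N Y" by (rule Y_integrable[OF mom])
  have 3: "integrable N (\<lambda>\<omega>. \<bar>Y \<omega>\<bar> * indicator {x. \<bar>x\<bar> > b n} (Y \<omega>))"
    by (rule Bochner_Integration.integrable_bound[OF 2]) (auto simp: indicator_def)
  have "\<bar>N.expectation (\<lambda>\<omega>. trunc n (Y \<omega>)) - N.expectation Y\<bar> = \<bar>N.expectation (\<lambda>\<omega>. trunc n (Y \<omega>) - Y \<omega>)\<bar>"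
    using 1 2 by simp
  also have "\<dots> \<le> N.expectation (\<lambda>\<omega>. \<bar>trunc n (Y \<omega>) - Y \<omega>\<bar>)"
    by (rule integral_abs_bound)
  also have "\<dots> \<le> tail n"
    unfolding tail_def
  proof (rule integral_mono[OF _ 3])
    show "integrable N (\<lambda>\<omega>. \<bar>trunc n (Y \<omega>) - Y \<omega>\<bar>)" using 1 2 by simp
    show "\<bar>trunc n (Y \<omega>) - Y \<omega>\<bar> \<le> \<bar>Y \<omega>\<bar> * indicator {x. \<bar>x\<bar> > b n} (Y \<omega>)" for \<omega>
      using \<open>b n > 0\<close> by (auto simp: trunc_def indicator_def)
  qed
  finally show ?thesis .
qed

text \<open>Unless some \<open>|X i|\<close> exceeds \<open>b n\<close>, the weighted sum centred at
  the true mean is the clipped sum centred at its own mean plus a deterministic bias. Half of the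
  threshold is reserved for each of the two.\<close>

lemma weighted_prob_le:
  assumes mom: "integrable N (\<lambda>\<omega>. G \<bar>Y \<omega>\<bar>)" and bn: "b n > 0" and n: "n \<ge> 1" and \<epsilon>: "\<epsilon> > 0"
    and a: "(\<Sum>i=1..n. (a i)\<^sup>2) \<le> C * real n"
    and bias: "(1 + C) * (real n * tail n) \<le> \<epsilon> / 2 * b n"
  shows "prob {\<omega> \<in> space M. max_partial_sum n (\<lambda>i. a i * (X i \<omega> - N.expectation Y)) > \<epsilon> * b n}
    \<le> (1 + 32 * C / \<epsilon>\<^sup>2) * (real n * V n)"
proof -
  define \<mu> where "\<mu> = N.expectation Y"
  define m where "m = N.expectation (\<lambda>\<omega>. trunc n (Y \<omega>))"
  define Z where "Z i \<omega> = trunc n (X i \<omega>) - m" for i \<omega>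
  have X [measurable]: "i \<ge> 1 \<Longrightarrow> X i \<in> borel_measurable M" for i by (rule X_rv)
  have Z [measurable]: "i \<ge> 1 \<Longrightarrow> Z i \<in> borel_measurable M" for i unfolding Z_def by measurable
  have tr: "\<bar>trunc n x\<bar> \<le> b n" for x using bn by (auto simp: trunc_def)
  have tr2: "(trunc n x)\<^sup>2 \<le> (b n)\<^sup>2" for x using tr[of x] bn by (simp add: abs_le_square_iff[symmetric])
  have int1: "i \<ge> 1 \<Longrightarrow> integrable M (\<lambda>\<omega>. trunc n (X i \<omega>))" for i
    by (rule integrable_const_bound[of _ "b n"]) (use tr in auto)
  have int2: "i \<ge> 1 \<Longrightarrow> integrable M (\<lambda>\<omega>. (trunc n (X i \<omega>))\<^sup>2)" for i
    by (rule integrable_const_bound[of _ "(b n)\<^sup>2"]) (use tr2 in auto)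
  have m: "i \<ge> 1 \<Longrightarrow> expectation (\<lambda>\<omega>. trunc n (X i \<omega>)) = m" for i
    unfolding m_def by (rule expectation_X) auto
  have sq: "(trunc n x)\<^sup>2 = (b n)\<^sup>2 * min 1 ((\<bar>x\<bar> / b n)\<^sup>2)" for x
  proof (cases "\<bar>x\<bar> \<le> b n")
    case True
    then have "(\<bar>x\<bar> / b n)\<^sup>2 \<le> 1" using bn by (intro power_le_one) auto
    then show ?thesis using True bn by (auto simp: trunc_def power_divide max_def min_def)
  next
    case False
    then have "1 \<le> (\<bar>x\<bar> / b n)\<^sup>2" using bn by (intro one_le_power) auto
    then show ?thesis using False bn by (auto simp: trunc_def max_def min_def abs_if split: if_splits)
  qed
  have Z2: "i \<ge> 1 \<Longrightarrow> integrable M (\<lambda>\<omega>. (Z i \<omega>)\<^sup>2)" for i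
    unfolding Z_def power2_diff using int1 int2 by simp
  have EZ: "i \<ge> 1 \<Longrightarrow> expectation (Z i) = 0" for i
    unfolding Z_def using int1 m by (simp add: prob_space)
  have EZ2: "expectation (\<lambda>\<omega>. (Z i \<omega>)\<^sup>2) \<le> (b n)\<^sup>2 * V n" if i: "i \<ge> 1" for i
  proof -
    have "expectation (\<lambda>\<omega>. (Z i \<omega>)\<^sup>2) = expectation (\<lambda>\<omega>. (trunc n (X i \<omega>))\<^sup>2 + m\<^sup>2 - 2 * m * trunc n (X i \<omega>))"
      unfolding Z_def power2_diff by (simp add: mult_ac)
    also have "\<dots> = expectation (\<lambda>\<omega>. (trunc n (X i \<omega>))\<^sup>2) - m\<^sup>2"
      using int1[OF i] int2[OF i] m[OF i] by (simp add: prob_space power2_eq_square)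
    also have "\<dots> \<le> expectation (\<lambda>\<omega>. (trunc n (X i \<omega>))\<^sup>2)" by simp
    also have "\<dots> = N.expectation (\<lambda>\<omega>. (trunc n (Y \<omega>))\<^sup>2)" by (rule expectation_X[OF i]) measurable
    also have "\<dots> = (b n)\<^sup>2 * V n" unfolding sq V_def by simp
    finally show ?thesis .
  qed
  \<comment> \<open>Clipping is nondecreasing in the value, unlike cutting off to 0 beyond the
    level, so negative association is inherited.\<close>
  have NAZ: "neg_associated M Z {1..}"
    unfolding Z_def by (rule neg_associated_comp_mono[OF NA]) (auto simp: mono_def trunc_def)
  have C0: "C \<ge> 0"
  proof -
    have "0 \<le> C * real n" using a by (rule order_trans[OF sum_nonneg, rotated]) auto
    then show ?thesis using n by (simp add: zero_le_mult_iff)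
  qed
  \<comment> \<open>The bias involves the first powers of the weights, while only their squares are
    controlled; \<open>|x| \<le> 1 + x^2\<close> bridges the gap and produces
    \<open>1 + C\<close>.\<close>
  have sum_a: "(\<Sum>i=1..n. \<bar>a i\<bar>) \<le> (1 + C) * real n"
  proof -
    have "\<bar>x\<bar> \<le> 1 + x\<^sup>2" for x :: real
      using sum_squares_bound[of "\<bar>x\<bar>" 1] abs_ge_zero[of x] unfolding power2_abs by simp
    then have "(\<Sum>i=1..n. \<bar>a i\<bar>) \<le> (\<Sum>i=1..n. 1 + (a i)\<^sup>2)" by (intro sum_mono)
    also have "\<dots> \<le> real n + C * real n" using a by (simp add: sum.distrib)
    finally show ?thesis by (simp add: algebra_simps)
  qed
  have big: "prob {\<omega> \<in> space M. \<bar>X i \<omega>\<bar> > b n} \<le> V n" if i: "i \<ge> 1" for i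
  proof -
    have "prob {\<omega> \<in> space M. \<bar>X i \<omega>\<bar> > b n} = N.prob {\<omega> \<in> space N. \<bar>Y \<omega>\<bar> > b n}"
      by (rule prob_X[OF i]) measurable
    also have "\<dots> = N.expectation (\<lambda>\<omega>. indicator {\<omega> \<in> space N. \<bar>Y \<omega>\<bar> > b n} \<omega>)" by simp
    also have "\<dots> \<le> V n"
      unfolding V_def
    proof (rule integral_mono)
      fix \<omega>
      show "indicator {\<omega> \<in> space N. \<bar>Y \<omega>\<bar> > b n} \<omega> \<le> min 1 ((\<bar>Y \<omega>\<bar> / b n)\<^sup>2)"
      proof (cases "\<bar>Y \<omega>\<bar> > b n")
        case True
        then have "1 \<le> (\<bar>Y \<omega>\<bar> / b n)\<^sup>2" using bn by (intro one_le_power) auto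
        then show ?thesis by (simp add: indicator_def)
      qed simp
    qed (use V_integrable in \<open>auto simp: integrable_indicator_iff less_top[symmetric]\<close>)
    finally show ?thesis .
  qed
  have [measurable]: "(\<lambda>\<omega>. max_partial_sum n (\<lambda>i. a i * Z i \<omega>)) \<in> borel_measurable M"
    using n by (intro measurable_max_partial_sum) auto
  define E1 where "E1 = (\<Union>i\<in>{1..n}. {\<omega> \<in> space M. \<bar>X i \<omega>\<bar> > b n})"
  define E2 where "E2 = {\<omega> \<in> space M. max_partial_sum n (\<lambda>i. a i * Z i \<omega>) > \<epsilon> / 2 * b n}"
  have E: "E1 \<in> sets M" "E2 \<in> sets M" unfolding E1_def E2_def by (auto intro!: sets.finite_UN)
  have "prob {\<omega> \<in> space M. max_partial_sum n (\<lambda>i. a i * (X i \<omega> - \<mu>)) > \<epsilon> * b n} \<le> prob (E1 \<union> E2)"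
  proof (rule finite_measure_mono)
    show "{\<omega> \<in> space M. max_partial_sum n (\<lambda>i. a i * (X i \<omega> - \<mu>)) > \<epsilon> * b n} \<subseteq> E1 \<union> E2"
    proof (rule subsetI, rule ccontr)
      fix \<omega> assume \<omega>: "\<omega> \<in> {\<omega> \<in> space M. max_partial_sum n (\<lambda>i. a i * (X i \<omega> - \<mu>)) > \<epsilon> * b n}" "\<omega> \<notin> E1 \<union> E2"
      then have small: "\<And>i. i \<in> {1..n} \<Longrightarrow> \<bar>X i \<omega>\<bar> \<le> b n" and z: "max_partial_sum n (\<lambda>i. a i * Z i \<omega>) \<le> \<epsilon> / 2 * b n"
        by (auto simp: E1_def E2_def not_less)
      have "max_partial_sum n (\<lambda>i. a i * (X i \<omega> - \<mu>)) = max_partial_sum n (\<lambda>i. a i * Z i \<omega> + a i * (m - \<mu>))"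
      proof (rule max_partial_sum_cong)
        fix i assume "i \<in> {1..n}"
        then have "trunc n (X i \<omega>) = X i \<omega>" using small[of i] by (auto simp: trunc_def)
        then show "a i * (X i \<omega> - \<mu>) = a i * Z i \<omega> + a i * (m - \<mu>)" by (simp add: Z_def algebra_simps)
      qed
      also have "\<dots> \<le> max_partial_sum n (\<lambda>i. a i * Z i \<omega>) + max_partial_sum n (\<lambda>i. a i * (m - \<mu>))"
        by (rule max_partial_sum_add[OF n])
      also have "max_partial_sum n (\<lambda>i. a i * (m - \<mu>)) \<le> (1 + C) * (real n * tail n)"
      proof (rule max_partial_sum_le[OF n])
        fix k assume k: "k \<in> {1..n}"
        have "\<bar>\<Sum>i=1..k. a i * (m - \<mu>)\<bar> \<le> (\<Sum>i=1..k. \<bar>a i * (m - \<mu>)\<bar>)" by (rule sum_abs)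
        also have "\<dots> \<le> (\<Sum>i=1..n. \<bar>a i * (m - \<mu>)\<bar>)" using k by (intro sum_mono2) auto
        also have "\<dots> = (\<Sum>i=1..n. \<bar>a i\<bar>) * \<bar>m - \<mu>\<bar>" by (simp add: abs_mult sum_distrib_right)
        also have "\<dots> \<le> (1 + C) * real n * tail n"
          using trunc_mean_le[OF mom bn] sum_a C0 unfolding m_def \<mu>_def by (intro mult_mono) auto
        finally show "\<bar>\<Sum>i=1..k. a i * (m - \<mu>)\<bar> \<le> (1 + C) * (real n * tail n)" by (simp add: mult_ac)
      qed
      finally show False using z bias \<omega>(1) by simp
    qed
  qed (use E in auto)
  also have "\<dots> \<le> prob E1 + prob E2" by (rule measure_Un_le) (use E in auto)
  also have "prob E1 \<le> (\<Sum>i=1..n. prob {\<omega> \<in> space M. \<bar>X i \<omega>\<bar> > b n})"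
    unfolding E1_def by (rule finite_measure_subadditive_finite) auto
  also have "\<dots> \<le> (\<Sum>i=1..n. V n)" using big by (intro sum_mono) auto
  also have "prob E2 \<le> 8 * (\<Sum>i=1..n. (a i)\<^sup>2 * expectation (\<lambda>\<omega>. (Z i \<omega>)\<^sup>2)) / (\<epsilon> / 2 * b n)\<^sup>2"
    unfolding E2_def by (rule neg_associated_weighted_maximal_inequality[OF NAZ Z Z2 EZ n]) (use \<epsilon> bn in auto)
  also have "\<dots> \<le> 8 * (\<Sum>i=1..n. (a i)\<^sup>2 * ((b n)\<^sup>2 * V n)) / (\<epsilon> / 2 * b n)\<^sup>2"
    using EZ2 by (intro divide_right_mono mult_left_mono sum_mono) auto
  also have "\<dots> = 8 * ((\<Sum>i=1..n. (a i)\<^sup>2) * ((b n)\<^sup>2 * V n)) / (\<epsilon> / 2 * b n)\<^sup>2"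
    by (simp add: sum_distrib_right)
  also have "\<dots> \<le> 8 * ((C * real n) * ((b n)\<^sup>2 * V n)) / (\<epsilon> / 2 * b n)\<^sup>2"
    using a V_nonneg by (intro divide_right_mono mult_left_mono mult_right_mono) auto
  \<comment> \<open>The 32 is the 8 of the maximal inequality times 4 from the halved threshold; the
    squares of \<open>b n\<close> cancel.\<close>
  also have "\<dots> = 32 * C / \<epsilon>\<^sup>2 * (real n * V n)"
    using bn \<epsilon> by (simp add: power_mult_distrib power_divide field_simps)
  finally show ?thesis by (simp add: algebra_simps \<mu>_def)
qed

text \<open>The weight \<open>1 / n\<close> cancels the number of summands in the probability bound,
  so the series is compared with that of \<open>V\<close>. Centring at the mean, instead of assuming
  mean 0, lets the result be used also where the mean is still unknown.\<close>

lemma weighted_summable: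
  assumes mom: "integrable N (\<lambda>\<omega>. G \<bar>Y \<omega>\<bar>)" and \<epsilon>: "\<epsilon> > 0"
    and a: "\<And>n. n \<ge> 1 \<Longrightarrow> (\<Sum>i=1..n. (a n i)\<^sup>2) \<le> C * real n"
  shows "summable (\<lambda>n. 1 / real n *
    prob {\<omega> \<in> space M. max_partial_sum n (\<lambda>i. a n i * (X i \<omega> - N.expectation Y)) > \<epsilon> * b n})"
proof (rule summable_comparison_test_ev[OF _ summable_mult[OF V_summable[OF mom], of "1 + 32 * C / \<epsilon>\<^sup>2"]])
  have "(\<lambda>n. (1 + C) * (real n * tail n / b n)) \<longlonglongrightarrow> (1 + C) * 0"
    by (intro tendsto_mult_left tail_tendsto mom)
  then have "\<forall>\<^sub>F n in sequentially. (1 + C) * (real n * tail n / b n) < \<epsilon> / 2"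
    by (rule order_tendstoD) (use \<epsilon> in simp)
  with b_ev_pos show "\<forall>\<^sub>F n in sequentially. norm (1 / real n *
    prob {\<omega> \<in> space M. max_partial_sum n (\<lambda>i. a n i * (X i \<omega> - N.expectation Y)) > \<epsilon> * b n}) \<le> (1 + 32 * C / \<epsilon>\<^sup>2) * V n"
  proof eventually_elim
    case (elim n)
    then have "(1 + C) * (real n * tail n) \<le> \<epsilon> / 2 * b n" by (simp add: field_simps)
    from weighted_prob_le[OF mom _ _ \<epsilon> a this] elim
    have "prob {\<omega> \<in> space M. max_partial_sum n (\<lambda>i. a n i * (X i \<omega> - N.expectation Y)) > \<epsilon> * b n}
      \<le> (1 + 32 * C / \<epsilon>\<^sup>2) * (real n * V n)" by simp
    then show ?case using elim by (simp add: field_simps)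
  qed
qed

section \<open>Necessity: from the strong law back to the moment and the mean\<close>

lemma strong_law_imp_moment:
  assumes slln: "AE \<omega> in M. (\<lambda>n. max_partial_sum n (\<lambda>i. X i \<omega>) / b n) \<longlonglongrightarrow> 0"
  shows "integrable N (\<lambda>\<omega>. G \<bar>Y \<omega>\<bar>)"
proof -
  have ev: "AE \<omega> in M. \<forall>\<^sub>F n in sequentially. \<bar>X n \<omega>\<bar> \<le> b n"
    using slln
  proof (rule AE_mp, intro AE_I2 impI)
    fix \<omega> assume "(\<lambda>n. max_partial_sum n (\<lambda>i. X i \<omega>) / b n) \<longlonglongrightarrow> 0"
    \<comment> \<open>\<open>X n\<close> is a difference of two partial sums, so a ratio below 1/2
      is what yields \<open>|X n| \<le> b n\<close>; \<open>n \<ge> 2\<close> ensures that both sums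
      occur in the maximum.\<close>
    then have "\<forall>\<^sub>F n in sequentially. max_partial_sum n (\<lambda>i. X i \<omega>) / b n < 1/2"
      by (rule order_tendstoD) simp
    with b_ev_pos eventually_ge_at_top[of 2] show "\<forall>\<^sub>F n in sequentially. \<bar>X n \<omega>\<bar> \<le> b n"
    proof eventually_elim
      case (elim n)
      obtain k where k: "n = Suc k" "k \<ge> 1" using elim by (cases n) auto
      have "\<bar>X n \<omega>\<bar> = \<bar>(\<Sum>i=1..n. X i \<omega>) - (\<Sum>i=1..k. X i \<omega>)\<bar>" using k by simp
      also have "\<dots> \<le> max_partial_sum n (\<lambda>i. X i \<omega>) + max_partial_sum n (\<lambda>i. X i \<omega>)"
        using max_partial_sum_ge[of n n "\<lambda>i. X i \<omega>"] max_partial_sum_ge[of k n "\<lambda>i. X i \<omega>"] k by auto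
      also have "\<dots> \<le> b n" using elim by (simp add: field_simps)
      finally show ?case .
    qed
  qed
  \<comment> \<open>The product inequality is one-sided, hence one application to the sequence and
    one to its reflection.\<close>
  have "summable (\<lambda>n. prob {\<omega> \<in> space M. X (Suc n) \<omega> > b (Suc n)})"
    by (rule neg_associated_Borel_Cantelli[OF NA X_rv]) (use ev in \<open>auto elim!: AE_mp eventually_mono\<close>)
  moreover have "summable (\<lambda>n. prob {\<omega> \<in> space M. - X (Suc n) \<omega> > b (Suc n)})"
    by (rule neg_associated_Borel_Cantelli[OF neg_associated_uminus[OF NA]])
      (use ev X_rv in \<open>auto elim!: AE_mp eventually_mono\<close>)
  ultimately have sm: "summable (\<lambda>n. prob {\<omega> \<in> space M. X (Suc n) \<omega> > b (Suc n)} + prob {\<omega> \<in> space M. - X (Suc n) \<omega> > b (Suc n)})"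
    by (rule summable_add)
  define Q where "Q n = N.prob {\<omega> \<in> space N. \<bar>Y \<omega>\<bar> > b n}" for n
  have "summable (\<lambda>n. Q (Suc n))"
  proof (rule summable_comparison_test_ev[OF _ sm], intro always_eventually allI)
    fix n
    have [measurable]: "X (Suc n) \<in> borel_measurable M" by (rule X_rv) simp
    have "Q (Suc n) = prob {\<omega> \<in> space M. \<bar>X (Suc n) \<omega>\<bar> > b (Suc n)}"
      unfolding Q_def by (rule prob_X[symmetric]) auto
    also have "\<dots> \<le> prob ({\<omega> \<in> space M. X (Suc n) \<omega> > b (Suc n)} \<union> {\<omega> \<in> space M. - X (Suc n) \<omega> > b (Suc n)})"
      by (rule finite_measure_mono) auto
    also have "\<dots> \<le> prob {\<omega> \<in> space M. X (Suc n) \<omega> > b (Suc n)} + prob {\<omega> \<in> space M. - X (Suc n) \<omega> > b (Suc n)}"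
      by (rule measure_Un_le) auto
    finally show "norm (Q (Suc n)) \<le> \<dots>" by (simp add: Q_def)
  qed
  then have Qs: "summable Q" by (rule summable_Suc_iff[THEN iffD1])
  obtain C where C: "C > 0" "\<forall>\<^sub>F n in sequentially. \<forall>t. 0 \<le> t \<and> t \<le> b n \<longrightarrow> G t \<le> C * real n"
    by (rule G_le_of_le_b) blast
  obtain n0 where n0: "\<And>n t. n \<ge> n0 \<Longrightarrow> 0 \<le> t \<Longrightarrow> t \<le> b n \<Longrightarrow> G t \<le> C * real n"
    using C(2) unfolding eventually_sequentially by blast
  define I where "I n = {\<omega> \<in> space N. \<bar>Y \<omega>\<bar> > b n}" for n
  have [measurable]: "I n \<in> sets N" for n unfolding I_def by measurable
  have pt: "ennreal (G \<bar>Y \<omega>\<bar>) \<le> ennreal C * (of_nat n0 + (\<Sum>n. indicator (I n) \<omega>))" if \<omega>: "\<omega> \<in> space N" for \<omega>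
  proof -
    have "\<forall>\<^sub>F n in sequentially. n \<ge> n0 \<and> b n \<ge> \<bar>Y \<omega>\<bar>"
      using b_at_top[unfolded filterlim_at_top] by (auto intro: eventually_conj eventually_ge_at_top)
    then have ex: "\<exists>n. n \<ge> n0 \<and> b n \<ge> \<bar>Y \<omega>\<bar>" by (rule eventually_happens'[rotated]) simp
    \<comment> \<open>As \<open>b\<close> may fail to be monotone, \<open>k\<close> is the first
      index from \<open>n0\<close> on with \<open>b k \<ge> |Y|\<close>. Every index from
      \<open>n0\<close> up to \<open>k - 1\<close> contributes 1 to the sum of indicators, so
      \<open>k\<close> is at most \<open>n0\<close> plus that sum, while \<open>G |Y|\<close> is at
      most \<open>C * k\<close>.\<close>
    define k where "k = (LEAST n. n \<ge> n0 \<and> b n \<ge> \<bar>Y \<omega>\<bar>)"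
    have k: "k \<ge> n0" "b k \<ge> \<bar>Y \<omega>\<bar>" using LeastI_ex[OF ex] by (auto simp: k_def)
    have less: "\<omega> \<in> I n" if "n \<ge> n0" "n < k" for n
      using not_less_Least[of n "\<lambda>n. n \<ge> n0 \<and> b n \<ge> \<bar>Y \<omega>\<bar>"] that \<omega> by (auto simp: k_def I_def)
    have "(of_nat (k - n0) :: ennreal) = (\<Sum>n=n0..<k. indicator (I n) \<omega>)"
      using less by simp
    also have "\<dots> \<le> (\<Sum>n. indicator (I n) \<omega>)" by (rule sum_le_suminf) auto
    finally have "(of_nat n0 :: ennreal) + of_nat (k - n0) \<le> of_nat n0 + (\<Sum>n. indicator (I n) \<omega>)"
      by (rule add_left_mono)
    then have kk: "(of_nat k :: ennreal) \<le> of_nat n0 + (\<Sum>n. indicator (I n) \<omega>)"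
      using k(1) by (simp flip: of_nat_add)
    have "ennreal (G \<bar>Y \<omega>\<bar>) \<le> ennreal (C * real k)" using n0[OF k(1) _ k(2)] by (intro ennreal_leI) simp
    also have "\<dots> = ennreal C * of_nat k" using C by (simp add: ennreal_mult ennreal_of_nat_eq_real_of_nat)
    also have "\<dots> \<le> ennreal C * (of_nat n0 + (\<Sum>n. indicator (I n) \<omega>))" by (intro mult_left_mono kk) simp
    finally show ?thesis .
  qed
  have "(\<integral>\<^sup>+\<omega>. ennreal (G \<bar>Y \<omega>\<bar>) \<partial>N) \<le> (\<integral>\<^sup>+\<omega>. ennreal C * (of_nat n0 + (\<Sum>n. indicator (I n) \<omega>)) \<partial>N)"
    by (rule nn_integral_mono) (rule pt)
  also have "\<dots> = ennreal C * (of_nat n0 + (\<Sum>n. emeasure N (I n)))"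
    by (simp add: nn_integral_cmult nn_integral_add nn_integral_suminf N.emeasure_space_1)
  also have "(\<Sum>n. emeasure N (I n)) = ennreal (suminf Q)"
    unfolding N.emeasure_eq_measure I_def Q_def[symmetric]
    by (rule suminf_ennreal2) (use Qs in \<open>simp_all add: Q_def[abs_def]\<close>)
  also have "ennreal C * (of_nat n0 + ennreal (suminf Q)) < \<infinity>"
    by (simp add: ennreal_mult_less_top of_nat_less_top)
  finally show ?thesis
    by (intro integrableI_nonneg) (auto simp: G_nonneg)
qed

lemma strong_law_imp_centered:
  assumes slln: "AE \<omega> in M. (\<lambda>n. max_partial_sum n (\<lambda>i. X i \<omega>) / b n) \<longlonglongrightarrow> 0"
  shows "N.expectation Y = 0"
proof -
  define \<mu> where "\<mu> = N.expectation Y"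
  have mom: "integrable N (\<lambda>\<omega>. G \<bar>Y \<omega>\<bar>)" by (rule strong_law_imp_moment[OF slln])
  obtain D where D: "D > 0" "\<forall>\<^sub>F n in sequentially. \<forall>m. n \<le> m \<and> m \<le> 2 * n \<longrightarrow> b m \<le> D * b n \<and> b n \<le> D * b m"
    by (rule b_comparable) blast
  have "AE \<omega> in M. (\<lambda>n. max_partial_sum n (\<lambda>i. X i \<omega> - \<mu>) / b n) \<longlonglongrightarrow> 0"
  proof (rule AE_max_partial_sum_tendsto[OF _ _ D])
    show "summable (\<lambda>n. 1 / real n * prob {\<omega> \<in> space M. max_partial_sum n (\<lambda>i. X i \<omega> - \<mu>) > \<epsilon> * b n})" if "\<epsilon> > 0" for \<epsilon>
      \<comment> \<open>Constant weights 1 satisfy the condition on the squares with constant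
        1.\<close>
      using weighted_summable[OF mom that, of "\<lambda>_ _. 1" 1] by (simp add: \<mu>_def)
    show "\<forall>\<^sub>F n in sequentially. b n > 0" using b_ev_pos by eventually_elim simp
  qed (use X_rv in auto)
  then have "AE \<omega> in M. (\<lambda>n. max_partial_sum n (\<lambda>i. X i \<omega>) / b n) \<longlonglongrightarrow> 0 \<and> (\<lambda>n. max_partial_sum n (\<lambda>i. X i \<omega> - \<mu>) / b n) \<longlonglongrightarrow> 0"
    using slln by (auto intro: AE_conjI)
  \<comment> \<open>Two almost sure properties hold together at some outcome; what remains is a
    deterministic comparison there, in which the two partial sums differ by
    \<open>n * \<mu>\<close>.\<close>
  then obtain \<omega> where "(\<lambda>n. max_partial_sum n (\<lambda>i. X i \<omega>) / b n) \<longlonglongrightarrow> 0"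
    "(\<lambda>n. max_partial_sum n (\<lambda>i. X i \<omega> - \<mu>) / b n) \<longlonglongrightarrow> 0"
    using eventually_happens'[OF ae_filter_bot] by blast
  from tendsto_add[OF this]
  have lim: "(\<lambda>n. max_partial_sum n (\<lambda>i. X i \<omega>) / b n + max_partial_sum n (\<lambda>i. X i \<omega> - \<mu>) / b n) \<longlonglongrightarrow> 0" by simp
  obtain C where C: "C > 0" "\<forall>\<^sub>F n in sequentially. b n \<le> C * real n" by (rule b_le_linear) blast
  have "\<forall>\<^sub>F n in sequentially. \<bar>\<mu>\<bar> / C \<le> max_partial_sum n (\<lambda>i. X i \<omega>) / b n + max_partial_sum n (\<lambda>i. X i \<omega> - \<mu>) / b n"
    using C(2) b_ev_pos
  proof eventually_elim
    case (elim n)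
    have "real n * \<bar>\<mu>\<bar> = \<bar>(\<Sum>i=1..n. X i \<omega>) - (\<Sum>i=1..n. X i \<omega> - \<mu>)\<bar>"
      by (simp add: sum_subtractf abs_mult)
    also have "\<dots> \<le> max_partial_sum n (\<lambda>i. X i \<omega>) + max_partial_sum n (\<lambda>i. X i \<omega> - \<mu>)"
      using max_partial_sum_ge[of n n "\<lambda>i. X i \<omega>"] max_partial_sum_ge[of n n "\<lambda>i. X i \<omega> - \<mu>"] elim by auto
    finally have 1: "real n * \<bar>\<mu>\<bar> / b n \<le> max_partial_sum n (\<lambda>i. X i \<omega>) / b n + max_partial_sum n (\<lambda>i. X i \<omega> - \<mu>) / b n"
      using elim by (simp add: divide_right_mono flip: add_divide_distrib)
    have "b n * \<bar>\<mu>\<bar> \<le> C * real n * \<bar>\<mu>\<bar>" using elim by (intro mult_right_mono) auto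
    then have "\<bar>\<mu>\<bar> / C \<le> real n * \<bar>\<mu>\<bar> / b n" using elim C by (simp add: field_simps)
    with 1 show ?case by linarith
  qed
  then have "\<bar>\<mu>\<bar> / C \<le> 0" by (rule tendsto_lowerbound[OF lim]) simp
  then show ?thesis using C by (simp add: \<mu>_def field_simps)
qed

end

theorem theorem3p1:
  fixes M :: "'a measure" and N :: "'b measure"
    and X :: "nat \<Rightarrow> 'a \<Rightarrow> real" and Y :: "'b \<Rightarrow> real"
    and L Lt :: "real \<Rightarrow> real" and A \<alpha> :: real and b :: "nat \<Rightarrow> real"
  assumes alpha: "1 \<le> \<alpha>" "\<alpha> < 2"
    and M: "prob_space M" and N: "prob_space N"
    and X_rv: "\<And>n. n \<ge> 1 \<Longrightarrow> X n \<in> borel_measurable M"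
    and Y_rv: "Y \<in> borel_measurable N"
    and same_distr: "\<And>n. n \<ge> 1 \<Longrightarrow> distr M borel (X n) = distr N borel Y"
    and NA: "neg_associated M X {1..}"
    and A_pos: "A > 0"
    and L: "slowly_varying A L"
    and Lt: "de_bruijn_conjugate A L Lt"
    and bounded: "bounded_on_intervals A L" "bounded_on_intervals A Lt"
    and alpha_1: "\<alpha> = 1 \<Longrightarrow> (\<forall>x\<ge>A. L x \<ge> 1) \<and> mono_on {A..} L"
    and b: "\<And>n. n \<ge> 1 \<Longrightarrow> real n \<ge> A powr \<alpha> \<Longrightarrow>
              b n = real n powr (1 / \<alpha>) * Lt (real n powr (1 / \<alpha>))"
  shows
    "let I = {n::nat. n \<ge> 1 \<and> real n \<ge> A powr \<alpha>};
         S1 = (integrable N Y \<and> (\<integral>\<omega>. Y \<omega> \<partial>N) = 0 \<and>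
               (\<integral>\<^sup>+\<omega>. ennreal (\<bar>Y \<omega>\<bar> powr \<alpha> * L (\<bar>Y \<omega>\<bar> + A) powr \<alpha>) \<partial>N) < \<infinity>);
         S2 = (\<forall>a :: nat \<Rightarrow> nat \<Rightarrow> real.
                (\<exists>C. \<forall>n\<ge>1. (\<Sum>i=1..n. (a n i)\<^sup>2) \<le> C * real n) \<longrightarrow>
                (\<forall>\<epsilon>>0. (\<lambda>n. 1 / real n *
                    measure M {\<omega> \<in> space M. max_partial_sum n (\<lambda>i. a n i * X i \<omega>) > \<epsilon> * b n})
                  summable_on I));
         S3 = (\<forall>\<epsilon>>0. (\<lambda>n. 1 / real n *
                    measure M {\<omega> \<in> space M. max_partial_sum n (\<lambda>i. X i \<omega>) > \<epsilon> * b n})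
                  summable_on I);
         S4 = (AE \<omega> in M. (\<lambda>n. max_partial_sum n (\<lambda>i. X i \<omega>) / b n) \<longlonglongrightarrow> 0)
     in (S1 \<longleftrightarrow> S2) \<and> (S2 \<longleftrightarrow> S3) \<and> (S3 \<longleftrightarrow> S4)"
proof -
  interpret neg_associated_sequence A \<alpha> L Lt b M N X Y
    by (intro neg_associated_sequence.intro de_bruijn_norming.intro neg_associated_sequence_axioms.intro)
      (fact alpha M N X_rv Y_rv same_distr NA L Lt bounded(1) alpha_1 b)+
  define I where "I = {n::nat. n \<ge> 1 \<and> real n \<ge> A powr \<alpha>}"
  define S1 where "S1 \<longleftrightarrow> integrable N Y \<and> (\<integral>\<omega>. Y \<omega> \<partial>N) = 0 \<and>
    (\<integral>\<^sup>+\<omega>. ennreal (\<bar>Y \<omega>\<bar> powr \<alpha> * L (\<bar>Y \<omega>\<bar> + A) powr \<alpha>) \<partial>N) < \<infinity>"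
  define P where "P a \<epsilon> n = 1 / real n *
    measure M {\<omega> \<in> space M. max_partial_sum n (\<lambda>i. a n i * X i \<omega>) > \<epsilon> * b n}"
    for a :: "nat \<Rightarrow> nat \<Rightarrow> real" and \<epsilon> n
  define S2 where "S2 \<longleftrightarrow> (\<forall>a. (\<exists>C. \<forall>n\<ge>1. (\<Sum>i=1..n. (a n i)\<^sup>2) \<le> C * real n) \<longrightarrow>
    (\<forall>\<epsilon>>0. P a \<epsilon> summable_on I))"
  define S3 where "S3 \<longleftrightarrow> (\<forall>\<epsilon>>0. P (\<lambda>_ _. 1) \<epsilon> summable_on I)"
  define S4 where "S4 \<longleftrightarrow> (AE \<omega> in M. (\<lambda>n. max_partial_sum n (\<lambda>i. X i \<omega>) / b n) \<longlonglongrightarrow> 0)"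
  have "- I \<subseteq> {..nat \<lceil>A powr \<alpha>\<rceil>}"
  proof
    fix n assume "n \<in> - I"
    then have "n = 0 \<or> real n < A powr \<alpha>" by (auto simp: I_def)
    then show "n \<in> {..nat \<lceil>A powr \<alpha>\<rceil>}" by (auto; linarith)
  qed
  then have finI: "finite (- I)" by (rule finite_subset) simp
  have on_I: "P a \<epsilon> summable_on I \<longleftrightarrow> summable (P a \<epsilon>)" for a \<epsilon>
    by (rule summable_on_cofinite_iff[OF _ finI]) (simp add: P_def)
  \<comment> \<open>The integrand is nonnegative, so a finite extended integral amounts to
    integrability of \<open>G |Y|\<close>.\<close>
  have moment: "(\<integral>\<^sup>+\<omega>. ennreal (\<bar>Y \<omega>\<bar> powr \<alpha> * L (\<bar>Y \<omega>\<bar> + A) powr \<alpha>) \<partial>N) < \<infinity>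
      \<longleftrightarrow> integrable N (\<lambda>\<omega>. G \<bar>Y \<omega>\<bar>)"
    by (subst integrable_iff_bounded) (simp add: G_nonneg, simp add: G_def)
  have "S2" if S1
    unfolding S2_def on_I
  proof (intro allI impI)
    fix a and \<epsilon> :: real
    assume "\<exists>C. \<forall>n\<ge>1. (\<Sum>i=1..n. (a n i)\<^sup>2) \<le> C * real n" and "\<epsilon> > 0"
    then obtain C where C: "\<And>n. n \<ge> 1 \<Longrightarrow> (\<Sum>i=1..n. (a n i)\<^sup>2) \<le> C * real n" by blast
    show "summable (P a \<epsilon>)"
      \<comment> \<open>The mean 0 contained in \<open>S1\<close> makes the centring
        disappear.\<close>
      using weighted_summable[OF _ \<open>\<epsilon> > 0\<close> C] that moment by (simp add: S1_def P_def[abs_def])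
  qed
  moreover have S3 if S2
    using that[unfolded S2_def, rule_format, of "\<lambda>_ _. 1"] by (auto simp: S3_def intro: exI[of _ 1])
  moreover have S4 if S3
  proof -
    obtain D where D: "D > 0" "\<forall>\<^sub>F n in sequentially. \<forall>m. n \<le> m \<and> m \<le> 2 * n \<longrightarrow> b m \<le> D * b n \<and> b n \<le> D * b m"
      by (rule b_comparable) blast
    show ?thesis
      unfolding S4_def
    proof (rule AE_max_partial_sum_tendsto[OF X_rv _ D])
      show "summable (\<lambda>n. 1 / real n * prob {\<omega> \<in> space M. max_partial_sum n (\<lambda>i. X i \<omega>) > \<epsilon> * b n})" if "\<epsilon> > 0" for \<epsilon>
        using \<open>S3\<close> that unfolding S3_def on_I by (simp add: P_def[abs_def])
      show "\<forall>\<^sub>F n in sequentially. b n > 0" using b_ev_pos by eventually_elim simp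
    qed
  qed
  moreover have S1 if S4
    unfolding S1_def moment
    using strong_law_imp_moment strong_law_imp_centered Y_integrable that by (simp add: S4_def)
  ultimately have "(S1 \<longleftrightarrow> S2) \<and> (S2 \<longleftrightarrow> S3) \<and> (S3 \<longleftrightarrow> S4)" by blast
  then show ?thesis
    by (simp add: Let_def S1_def S2_def S3_def S4_def I_def P_def[abs_def])
qed

end
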